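(* Let $G=(V,E)$ be a graph with $n$ nodes and $m$ edges, let $H$ be a graph with $p \leq \log n$ nodes and $k$ edges, and let $x=n^{1/p}$ and $\tilde{m}=\max\{m,nx\}$. There exists a deterministic Congested Clique algorithm that, given an $H$-partition tree $T$ of $G$ that is known to all nodes, completes in $O\!\left(\frac{k\tilde{m}}{n^{1+2/p}} + p\right)$ rounds and lists all instances of $H$ in $G$.
   Context: $x$ is rounded to an integer (note $x\ge 2$). For $A,B\subseteq V$, $E(A,B)=\{\{a,b\}\in E: a\in A, b\in B\}$. A $p$-partition tree is a rooted tree with $p$ layers (depth $p-1$) in which each non-leaf node has at most $x$ children and each tree node is associated with a partition of $V$ into at most $x$ parts. The root's partition is $P_\emptyset$; if a tree node has partition $P_{(\ell_1,\dots,\ell_{i-1})}$, its $j$-th child ($0\le j\le x-1$) has partition $P_{(\ell_1,\dots,\ell_{i-1},j)}$. The parts of $P_{(\ell_1,\dots,\ell_i)}$ are $U_{(\ell_1,\dots,\ell_i),j}$, $0\le j\le x-1$, and the part $U_{(\ell_1,\dots,\ell_{i-1}),\ell_i}$ is the parent of every part $U_{(\ell_1,\dots,\ell_i),j}$. A part of a partition indexed by a tuple of length $i$ is at depth $i$; its ancestors are $U_t$ for $t=i-1,\dots,0$, where $U_i$ is the part itself and $U_t=\mathrm{parent}(U_{t+1})$. Let $H$ have nodes $z_0,\dots,z_{p-1}$ and $d_i=|\{\{z_i,z_t\}\in E_H: t<i\}|$. An $H$-partition tree is a $p$-partition tree such that, for some constants $c_1,c_2$: (1) every part $U$ satisfies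 $|E(U,V)|\le c_1 m/x+n$; (2) every part $U_i$ at depth $i$, with ancestors $U_{i-1},\dots,U_0$, satisfies $\sum_{t<i,\ \{z_i,z_t\}\in E_H}|E(U_i,U_t)|\le c_2 d_i\tilde m/x^2+n$. Congested Clique model: the $n$ vertices of $G$ are synchronous processors; in each round every pair may exchange an $O(\log n)$-bit message; initially each node knows its incident edges. Listing all instances of $H$ means the union of the sets of copies of $H$ output by the nodes is exactly the set of copies of $H$ in $G$. *)

theory Defs
  imports Complex_Main "HOL-Library.Disjoint_Sets"
begin

section \<open>Graphs and copies\<close>

record ugraph =
  verts :: "nat set"
  edges :: "nat set set"

definition simple_graph :: "ugraph \<Rightarrow> bool" where
  "simple_graph G \<longleftrightarrow> finite (verts G) \<and> (\<forall>e\<in>edges G. e \<subseteq> verts G \<and> card e = 2)"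

definition edges_between :: "ugraph \<Rightarrow> nat set \<Rightarrow> nat set \<Rightarrow> nat set set" where
  "edges_between G A B = {{a, b} | a b. a \<in> A \<and> b \<in> B \<and> {a, b} \<in> edges G}"

definition incident_edges :: "ugraph \<Rightarrow> nat \<Rightarrow> nat set set" where
  "incident_edges G v = {e \<in> edges G. v \<in> e}"

definition subgraph :: "ugraph \<Rightarrow> ugraph \<Rightarrow> bool" where
  "subgraph S G \<longleftrightarrow> simple_graph S \<and> verts S \<subseteq> verts G \<and> edges S \<subseteq> edges G"

definition isomorphic :: "ugraph \<Rightarrow> ugraph \<Rightarrow> bool" where
  "isomorphic H S \<longleftrightarrow>
     (\<exists>f. bij_betw f (verts H) (verts S) \<and> edges S = (\<lambda>e. f ` e) ` edges H)"

text \<open>Instances are not-necessarily-induced subgraphs, counted as subgraphs and not as embeddings.\<close>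

definition copies :: "ugraph \<Rightarrow> ugraph \<Rightarrow> ugraph set" where
  "copies H G = {S. subgraph S G \<and> isomorphic H S}"


section \<open>Partition trees\<close>

text \<open>
  A tree maps the index tuple \<open>s\<close> of a tree node to the list of the parts of its partition,
  so that \<open>T s ! j\<close> is the part \<open>U\<^sub>s\<^sub>,\<^sub>j\<close>.  Every part of a non-leaf node is the parent of the
  parts of exactly one child, so the children of \<open>s\<close> are the nodes \<open>s @ [j]\<close> with
  \<open>j < length (T s)\<close>.  Values of \<open>T\<close> outside \<open>tree_nodes p T\<close> are irrelevant.
\<close>

type_synonym ptree = "nat list \<Rightarrow> nat set list"

definition tree_nodes :: "nat \<Rightarrow> ptree \<Rightarrow> nat list set" where
  "tree_nodes p T = {s. length s < p \<and> (\<forall>i<length s. s ! i < length (T (take i s)))}"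

text \<open>Parts may be empty, which only makes the notion more general.\<close>

definition is_partition :: "nat set \<Rightarrow> nat set list \<Rightarrow> bool" where
  "is_partition V Us \<longleftrightarrow>
     \<Union> (set Us) = V \<and> disjoint_family_on (\<lambda>j. Us ! j) {..<length Us}"

definition partition_tree :: "nat \<Rightarrow> nat \<Rightarrow> nat set \<Rightarrow> ptree \<Rightarrow> bool" where
  "partition_tree p x V T \<longleftrightarrow>
     (\<forall>s\<in>tree_nodes p T. is_partition V (T s) \<and> length (T s) \<le> x)"

text \<open>
  The part \<open>U\<^sub>s\<^sub>,\<^sub>j\<close> has depth \<open>i = length s\<close>; \<open>ancestor T s j t\<close> is its ancestor at
  depth \<open>t \<le> i\<close>, in particular \<open>ancestor T s j i\<close> is the part itself.
\<close>

definition ancestor :: "ptree \<Rightarrow> nat list \<Rightarrow> nat \<Rightarrow> nat \<Rightarrow> nat set" where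
  "ancestor T s j t = T (take t s) ! ((s @ [j]) ! t)"

definition back_degree :: "ugraph \<Rightarrow> nat \<Rightarrow> nat" where
  "back_degree H i = card {{i, t} | t. t < i \<and> {i, t} \<in> edges H}"

text \<open>Rounding down guarantees \<open>x ^ p \<le> n\<close>, and still \<open>x \<ge> 2\<close> when \<open>1 \<le> p \<le> log 2 n\<close>.\<close>

definition branching :: "nat \<Rightarrow> nat \<Rightarrow> nat" where
  "branching n p = nat \<lfloor>real n powr (1 / real p)\<rfloor>"

definition m_tilde :: "nat \<Rightarrow> nat \<Rightarrow> nat \<Rightarrow> real" where
  "m_tilde n m x = max (real m) (real n * real x)"

text \<open>The nodes \<open>z\<^sub>0, \<dots>, z\<^sub>p\<^sub>-\<^sub>1\<close> of \<open>H\<close> are the numbers \<open>0, \<dots>, p - 1\<close>.\<close>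

definition H_partition_tree ::
  "real \<Rightarrow> real \<Rightarrow> nat \<Rightarrow> nat \<Rightarrow> ugraph \<Rightarrow> ugraph \<Rightarrow> ptree \<Rightarrow> bool" where
  "H_partition_tree c1 c2 p x H G T \<longleftrightarrow>
     (let n = card (verts G); m = card (edges G) in
        partition_tree p x (verts G) T \<and>
        (\<forall>s\<in>tree_nodes p T. \<forall>j<length (T s).
           real (card (edges_between G (T s ! j) (verts G))) \<le> c1 * real m / real x + real n) \<and>
        (\<forall>s\<in>tree_nodes p T. \<forall>j<length (T s).
           let i = length s in
             (\<Sum>t | t < i \<and> {i, t} \<in> edges H.
                real (card (edges_between G (ancestor T s j i) (ancestor T s j t))))
             \<le> c2 * real (back_degree H i) * m_tilde n m x / (real x)\<^sup>2 + real n))"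


section \<open>The Congested Clique\<close>

text \<open>
  The processors are \<open>0, \<dots>, n - 1\<close>.  Local computation is unbounded, so a deterministic
  algorithm is a pair of functions of what a node has seen so far: its input and, for each
  past round, the messages received in that round.  The empty message stands for silence.
  A node halts as soon as \<open>decide\<close> yields an output; from then on it neither sends nor
  receives.
\<close>

type_synonym message = "bool list"
type_synonym history = "(nat \<Rightarrow> message) list"

record ('i, 'o) cc_algorithm =
  send :: "'i \<Rightarrow> history \<Rightarrow> nat \<Rightarrow> message"
  decide :: "'i \<Rightarrow> history \<Rightarrow> 'o option"

definition outgoing ::
  "('i, 'o) cc_algorithm \<Rightarrow> nat \<Rightarrow> (nat \<Rightarrow> 'i) \<Rightarrow> (nat \<Rightarrow> history) \<Rightarrow> nat \<Rightarrow> nat \<Rightarrow> message" where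
  "outgoing A n inp hist u v =
     (if u < n \<and> v < n \<and> u \<noteq> v \<and> decide A (inp u) (hist u) = None
      then send A (inp u) (hist u) v else [])"

primrec histories ::
  "('i, 'o) cc_algorithm \<Rightarrow> nat \<Rightarrow> (nat \<Rightarrow> 'i) \<Rightarrow> nat \<Rightarrow> nat \<Rightarrow> history" where
  "histories A n inp 0 = (\<lambda>v. [])"
| "histories A n inp (Suc r) =
     (\<lambda>v. let hist = histories A n inp r in
        if decide A (inp v) (hist v) = None
        then hist v @ [\<lambda>u. outgoing A n inp hist u v] else hist v)"

definition respects_bandwidth ::
  "('i, 'o) cc_algorithm \<Rightarrow> nat \<Rightarrow> (nat \<Rightarrow> 'i) \<Rightarrow> real \<Rightarrow> bool" where
  "respects_bandwidth A n inp b \<longleftrightarrow>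
     (\<forall>r u v. real (length (outgoing A n inp (histories A n inp r) u v)) \<le> b)"

definition node_output ::
  "('i, 'o) cc_algorithm \<Rightarrow> nat \<Rightarrow> (nat \<Rightarrow> 'i) \<Rightarrow> nat \<Rightarrow> nat \<Rightarrow> 'o option" where
  "node_output A n inp r v = decide A (inp v) (histories A n inp r v)"

definition completes_within ::
  "('i, 'o) cc_algorithm \<Rightarrow> nat \<Rightarrow> (nat \<Rightarrow> 'i) \<Rightarrow> nat \<Rightarrow> bool" where
  "completes_within A n inp r \<longleftrightarrow> (\<forall>v<n. node_output A n inp r v \<noteq> None)"


section \<open>Listing with a known partition tree\<close>

record node_input =
  net_size :: nat
  ident :: nat
  incident :: "nat set set"
  pattern :: ugraph
  known_tree :: ptree

definition graph_input :: "ugraph \<Rightarrow> ugraph \<Rightarrow> ptree \<Rightarrow> nat \<Rightarrow> node_input" where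
  "graph_input G H T v =
     \<lparr>net_size = card (verts G), ident = v, incident = incident_edges G v,
      pattern = H, known_tree = T\<rparr>"

definition lists_instances ::
  "(node_input, ugraph set) cc_algorithm \<Rightarrow> nat \<Rightarrow> ugraph \<Rightarrow> ugraph \<Rightarrow> ptree \<Rightarrow> nat \<Rightarrow> bool" where
  "lists_instances A n H G T r \<longleftrightarrow>
     (\<Union>v<n. the (node_output A n (graph_input G H T) r v)) = copies H G"

end

theory Submission
  imports Defs "HOL-Library.Nat_Bijection" "HOL-Library.Multiset" "HOL-Library.Discrete_Functions"
begin

text \<open>
  There are at most \<open>x ^ p \<le> n\<close> leaf parts, each given by a path in the tree, so every path gets a
  node of the clique of its own. That node learns all edges between the parts \<open>U\<^sub>i\<close> and \<open>U\<^sub>t\<close> on its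
  path with \<open>{z\<^sub>i, z\<^sub>t} \<in> E\<^sub>H\<close>, and any copy of \<open>H\<close> lies along some path. By the second tree condition
  a node receives \<open>O(k m_tilde / x\<^sup>2 + p n)\<close> edges. After the edges have been distributed evenly, a node
  sends each of its at most \<open>m / n + 1\<close> edges to at most \<open>2 k x ^ (p - 2)\<close> paths, since an edge that
  joins \<open>U\<^sub>i\<close> and \<open>U\<^sub>t\<close> fixes two coordinates of the path. It remains to route messages
  deterministically when every node sends and receives at most \<open>K n\<close> of them: this takes \<open>O(K)\<close>
  rounds if intermediate nodes are chosen by greedy edge colourings of bipartite multigraphs, whose
  multiplicities can be made known within groups of about \<open>\<surd>n\<close> nodes in \<open>O(1)\<close> rounds.
\<close>

section \<open>Encoding messages\<close>

text \<open>No node knows \<open>m\<close> or the constants of the tree, so no round count can be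
  fixed in advance, and a colouring helps only if all nodes concerned compute the same one.
  \<open>knows F B\<close> is made for this: a single algorithm for all instances gives every node
  \<open>v\<close> the value \<open>F x v\<close>, in a common round. Local computation then reduces
  to the claim that instances with equal views have equal values, and phases compose without mention
  of histories. Round counts are measured maxima that are broadcast before each phase, so the
  algorithm and its bandwidth factor can be chosen before \<open>c1\<close> and \<open>c2\<close>.

  Groups have about sqrt n nodes because the traffic of one group towards all groups is then
  described by about sqrt n * sqrt n = n numbers, which each member can receive in O(1) rounds; the
  full matrix has n^2 entries.

  In units of n, a node sends at most (m / n + 1) * 2 k x^(p-2) / n packets, which is at most 4 k
  m_tilde / (n x^2) because x^p \<le> n. The summand p of the running time collects the
  \<open>+ n\<close> of the second tree condition over the p depths of a path.\<close>

fun bits :: "nat \<Rightarrow> bool list" where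
  "bits k = (if k = 0 then [] else odd k # bits (k div 2))"

declare bits.simps [simp del]

lemma bits_eq_Nil_iff [simp]: "bits k = [] \<longleftrightarrow> k = 0"
  by (simp add: bits.simps)

lemma inj_bits: "inj bits"
proof (rule injI)
  show "k = l" if "bits k = bits l" for k l
    using that
  proof (induction k arbitrary: l rule: less_induct)
    case (less k)
    show ?case
    proof (cases "k = 0 \<or> l = 0")
      case True
      then show ?thesis
        using less.prems by (metis bits_eq_Nil_iff)
    next
      case False
      then have "odd k = odd l" "bits (k div 2) = bits (l div 2)"
        using less.prems by (simp_all add: bits.simps[of k] bits.simps[of l])
      moreover from this(2) have "k div 2 = l div 2"
        using False by (intro less.IH) auto
      ultimately show ?thesis
        by (metis div_mult_mod_eq odd_iff_mod_2_eq_one even_iff_mod_2_eq_zero)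
    qed
  qed
qed

lemma two_power_length_bits: "k > 0 \<Longrightarrow> 2 ^ length (bits k) \<le> 2 * k"
proof (induction k rule: less_induct)
  case (less k)
  show ?case
  proof (cases "k div 2 = 0")
    case True
    then have "k = 1" using less.prems by simp
    then show ?thesis by (simp add: bits.simps)
  next
    case False
    then have "2 ^ length (bits (k div 2)) \<le> 2 * (k div 2)"
      using less.prems by (intro less.IH) auto
    then show ?thesis
      using less.prems by (simp add: bits.simps[of k])
  qed
qed

lemma length_bits_le:
  assumes "n \<ge> 2" and "k \<le> n ^ c"
  shows "real (length (bits k)) \<le> real (c + 1) * log 2 (real n)"
proof (cases "k = 0")
  case True
  then show ?thesis using assms(1) by (simp add: bits.simps zero_le_mult_iff)
next
  case False
  have "2 ^ length (bits k) \<le> 2 * k"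
    using two_power_length_bits False by simp
  also have "\<dots> \<le> n * n ^ c"
    using assms by (intro mult_mono) auto
  finally have "2 ^ length (bits k) \<le> n ^ (c + 1)"
    by simp
  then have "(2::real) ^ length (bits k) \<le> real n ^ (c + 1)"
    by (metis of_nat_le_iff of_nat_numeral of_nat_power)
  then have "log 2 (2 ^ length (bits k)) \<le> log 2 (real n ^ (c + 1))"
    using assms(1) by (subst log_le_cancel_iff) auto
  then show ?thesis
    using assms(1) by (simp add: log_nat_power del: power_Suc)
qed

type_synonym packet = "nat \<times> nat \<times> nat"

text \<open>The successor keeps the code nonempty, since the empty message stands for
  silence.\<close>

definition encode_packet :: "packet \<Rightarrow> message" where
  "encode_packet = (\<lambda>(a, b, c). bits (Suc (prod_encode (a, prod_encode (b, c)))))"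

lemma encode_packet_neq_Nil [simp]: "encode_packet t \<noteq> []"
  by (simp add: encode_packet_def split: prod.splits)

lemma inj_encode_packet: "inj encode_packet"
  unfolding encode_packet_def
  by (rule injI) (auto simp: inj_eq[OF inj_bits] prod_encode_eq)

definition packet_bounded :: "nat \<Rightarrow> packet \<Rightarrow> bool" where
  "packet_bounded N = (\<lambda>(a, b, c). a \<le> N \<and> b \<le> N \<and> c \<le> N)"

lemma prod_encode_le:
  assumes "a \<le> N" "b \<le> N" "N \<ge> 2"
  shows "prod_encode (a, b) \<le> N ^ 6"
proof -
  have "triangle (a + b) \<le> (a + b) * Suc (a + b)"
    by (simp add: triangle_def)
  then have "prod_encode (a, b) \<le> (a + b) * Suc (a + b) + a"
    by (simp add: prod_encode_def)
  also have "\<dots> \<le> (2 * N + 1) ^ 2"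
  proof -
    have "(a + b) * Suc (a + b) \<le> (2 * N) * Suc (2 * N)"
      using assms by (intro mult_mono) auto
    then show ?thesis
      using assms by (simp add: power2_eq_square algebra_simps)
  qed
  also have "\<dots> \<le> (N ^ 3) ^ 2"
  proof (rule power_mono)
    have "2 * 2 * N \<le> N * N * N"
      using assms by (intro mult_mono) auto
    then have "4 * N \<le> N ^ 3"
      by (simp add: power3_eq_cube)
    then show "2 * N + 1 \<le> N ^ 3"
      using assms(3) by linarith
  qed simp
  finally show ?thesis
    by (simp flip: power_mult)
qed

lemma length_encode_packet_le:
  assumes "n \<ge> 2" and "packet_bounded (n ^ d) t"
  shows "real (length (encode_packet t)) \<le> real (37 * (d + 1) + 1) * log 2 (real n)"
proof -
  obtain a b c where t: "t = (a, b, c)" by (cases t)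
  \<comment> \<open>One power more than \<open>d\<close> gives N \<ge> 2 even for d = 0, as
    \<open>prod_encode_le\<close> requires.\<close>
  define N where "N = n ^ (d + 1)"
  have N: "N \<ge> 2"
    unfolding N_def using assms(1) by (intro order.trans[OF _ self_le_power]) auto
  have "n ^ d \<le> N"
    unfolding N_def using assms(1) by (intro power_increasing) auto
  then have abc: "a \<le> N" "b \<le> N" "c \<le> N"
    using assms(2) by (auto simp: packet_bounded_def t)
  have le6: "N \<le> N ^ 6"
    using N self_le_power[of N 6] by simp
  have "prod_encode (a, prod_encode (b, c)) \<le> (N ^ 6) ^ 6"
    using abc N le6 by (intro prod_encode_le) (auto intro: prod_encode_le order.trans)
  then have "Suc (prod_encode (a, prod_encode (b, c))) \<le> N ^ 36 + 1"
    by (simp flip: power_mult)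
  \<comment> \<open>Two nested pairings give the exponent 6 * 6; the successor is absorbed by a 37th
    factor N.\<close>
  also have "\<dots> \<le> N ^ 36 + N ^ 36"
    using N by simp
  also have "\<dots> \<le> N * N ^ 36"
    using N by (metis mult_2 mult_le_mono1)
  also have "\<dots> = n ^ (37 * (d + 1))"
    unfolding N_def power_mult[symmetric] power_add[symmetric] by (rule arg_cong) simp
  finally have "Suc (prod_encode (a, prod_encode (b, c))) \<le> n ^ (37 * (d + 1))" .
  from length_bits_le[OF assms(1) this] show ?thesis
    by (simp only: encode_packet_def t prod.case)
qed

section \<open>Composing algorithms\<close>

definition halts_at ::
  "('i, 'o) cc_algorithm \<Rightarrow> nat \<Rightarrow> (nat \<Rightarrow> 'i) \<Rightarrow> nat \<Rightarrow> (nat \<Rightarrow> 'o) \<Rightarrow> bool" where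
  "halts_at A n inp R out \<longleftrightarrow>
     (\<forall>v<n. (\<forall>r<R. node_output A n inp r v = None) \<and> node_output A n inp R v = Some (out v))"

lemma histories_halted:
  assumes "decide A (inp v) (histories A n inp r v) \<noteq> None"
  shows "histories A n inp (r + d) v = histories A n inp r v"
  using assms by (induction d) (auto simp: Let_def)

lemma halted_stays:
  assumes "halts_at A n inp R out" "v < n" "r \<ge> R"
  shows "decide A (inp v) (histories A n inp r v) = Some (out v)"
proof -
  have *: "decide A (inp v) (histories A n inp R v) = Some (out v)"
    using assms by (simp add: halts_at_def node_output_def)
  then have "histories A n inp (R + (r - R)) v = histories A n inp R v"
    by (intro histories_halted) simp
  with * show ?thesis using assms(3) by simp
qed

lemma histories_Suc_running:
  assumes "decide A (inp v) (histories A n inp r v) = None"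
  shows "histories A n inp (Suc r) v =
    histories A n inp r v @ [\<lambda>u. outgoing A n inp (histories A n inp r) u v]"
  using assms by (simp add: Let_def)

lemma length_histories:
  assumes "halts_at A n inp R out" "v < n" "r \<le> R"
  shows "length (histories A n inp r v) = r"
  using assms(3)
proof (induction r)
  case (Suc r)
  then have "decide A (inp v) (histories A n inp r v) = None"
    using assms(1,2) by (simp add: halts_at_def node_output_def)
  with Suc show ?case by (simp add: Let_def)
qed simp

text \<open>An algorithm that continues after \<open>A\<close> sees only its own longer history.
  Since earlier views are prefixes of later ones, it can recompute from them when \<open>A\<close>
  halted and with which output.\<close>

lemma take_histories:
  assumes "halts_at A n inp R out" "v < n" "r \<le> r'" "r' \<le> R"
  shows "take r (histories A n inp r' v) = histories A n inp r v"
  using assms(3,4)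
proof (induction r' rule: dec_induct)
  case base
  then show ?case using length_histories[OF assms(1,2)] by simp
next
  case (step m)
  then have "decide A (inp v) (histories A n inp m v) = None"
    using assms(1,2) by (simp add: halts_at_def node_output_def)
  with step length_histories[OF assms(1,2), of m] show ?case by (simp add: Let_def)
qed

lemma histories_cong:
  assumes "\<And>i h. decide A' i h = None \<longleftrightarrow> decide A i h = None" "\<And>i h w. send A' i h w = send A i h w"
  shows "histories A' n inp r = histories A n inp r"
  by (induction r) (auto simp: Let_def fun_eq_iff outgoing_def assms)

text \<open>\<open>X\<close> is the set of instances that one algorithm has to serve, so a node is
  ignorant of everything about \<open>x\<close> that its input leaves open. The second assumption
  says that an input reveals at least the size of the network and the identity of the node.\<close>

locale clique_inputs =
  fixes X :: "'x set" and net :: "'x \<Rightarrow> nat" and inp :: "'x \<Rightarrow> nat \<Rightarrow> 'i"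
  assumes net_ge_2: "x \<in> X \<Longrightarrow> net x \<ge> 2"
    and inp_eqD: "x \<in> X \<Longrightarrow> y \<in> X \<Longrightarrow> u < net x \<Longrightarrow> v < net y \<Longrightarrow> inp x u = inp y v \<Longrightarrow>
      net x = net y \<and> u = v"
begin

text \<open>All nodes halt simultaneously, so that the next phase of an algorithm can start in a
  common round; \<open>B\<close> only bounds that round.\<close>

definition knows :: "('x \<Rightarrow> nat \<Rightarrow> 'a) \<Rightarrow> ('x \<Rightarrow> nat) \<Rightarrow> bool" where
  "knows F B \<longleftrightarrow> (\<exists>(A :: ('i, 'a) cc_algorithm) \<beta>. \<forall>x\<in>X.
     respects_bandwidth A (net x) (inp x) (\<beta> * log 2 (real (net x))) \<and>
     (\<exists>R\<le>B x. halts_at A (net x) (inp x) R (F x)))"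

lemma knows_mono:
  assumes "knows F B" "\<And>x. x \<in> X \<Longrightarrow> B x \<le> B' x"
  shows "knows F B'"
  using assms unfolding knows_def by (meson order.trans)

lemma knows_input: "knows inp (\<lambda>x. 0)"
proof -
  define A :: "('i, 'i) cc_algorithm" where
    "A = \<lparr>send = \<lambda>i h w. [], decide = \<lambda>i h. Some i\<rparr>"
  have "respects_bandwidth A (net x) (inp x) (0 * log 2 (real (net x)))" for x
    by (simp add: respects_bandwidth_def outgoing_def A_def)
  moreover have "halts_at A (net x) (inp x) 0 (inp x)" for x
    by (simp add: halts_at_def node_output_def A_def)
  ultimately show ?thesis
    unfolding knows_def by blast
qed

text \<open>Local computation is unbounded, so a node knows whatever its view determines.\<close>

lemma knows_determined:
  assumes "knows F B"
    and det: "\<And>x y u. x \<in> X \<Longrightarrow> y \<in> X \<Longrightarrow> net y = net x \<Longrightarrow> u < net x \<Longrightarrow>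
      inp x u = inp y u \<Longrightarrow> F x u = F y u \<Longrightarrow> G x u = G y u"
  shows "knows G B"
proof -
  obtain A \<beta> where A: "\<And>x. x \<in> X \<Longrightarrow>
      respects_bandwidth A (net x) (inp x) (\<beta> * log 2 (real (net x))) \<and>
      (\<exists>R\<le>B x. halts_at A (net x) (inp x) R (F x))"
    using assms(1) unfolding knows_def by blast
  \<comment> \<open>Any instance compatible with the view may be consulted: by \<open>det\<close>
    all of them yield the same value.\<close>
  define h where "h i f = (SOME g. \<exists>x\<in>X. \<exists>u<net x. inp x u = i \<and> F x u = f \<and> G x u = g)" for i f
  have h: "h (inp x u) (F x u) = G x u" if "x \<in> X" "u < net x" for x u
    unfolding h_def
  proof (rule some_equality)
    fix g assume "\<exists>y\<in>X. \<exists>w<net y. inp y w = inp x u \<and> F y w = F x u \<and> G y w = g"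
    then obtain y w where "y \<in> X" "w < net y" "inp y w = inp x u" "F y w = F x u" "G y w = g"
      by blast
    moreover from this inp_eqD that have "net y = net x" "w = u" by metis+
    ultimately show "g = G x u" using det[of y x u] that by simp
  qed (use that in blast)
  define A' where "A' = \<lparr>send = send A, decide = \<lambda>i hi. map_option (h i) (decide A i hi)\<rparr>"
  have hist: "histories A' n ip r = histories A n ip r" for n ip r
    by (rule histories_cong) (auto simp: A'_def)
  have out: "outgoing A' n ip = outgoing A n ip" for n ip
    by (auto simp: fun_eq_iff outgoing_def A'_def)
  have "respects_bandwidth A' (net x) (inp x) (\<beta> * log 2 (real (net x))) \<and>
      (\<exists>R\<le>B x. halts_at A' (net x) (inp x) R (G x))" if x: "x \<in> X" for x
  proof
    show "respects_bandwidth A' (net x) (inp x) (\<beta> * log 2 (real (net x)))"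
      using A[OF x] by (simp add: respects_bandwidth_def hist out)
    obtain R where R: "R \<le> B x" "halts_at A (net x) (inp x) R (F x)"
      using A[OF x] by blast
    then have "halts_at A' (net x) (inp x) R (G x)"
      unfolding halts_at_def node_output_def hist by (simp add: A'_def h x)
    with R(1) show "\<exists>R\<le>B x. halts_at A' (net x) (inp x) R (G x)" by blast
  qed
  then show ?thesis unfolding knows_def by blast
qed

text \<open>When \<open>L x\<close> is common knowledge, \<open>L x\<close> rounds suffice to exchange lists of at most
  \<open>L x\<close> packets per ordered pair of nodes.\<close>

lemma knows_exchange:
  fixes F :: "'x \<Rightarrow> nat \<Rightarrow> 'b"
  assumes "knows (\<lambda>x u. (F x u, msg x u, L x)) B"
    and len: "\<And>x u v. x \<in> X \<Longrightarrow> u < net x \<Longrightarrow> v < net x \<Longrightarrow> length (msg x u v) \<le> L x"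
    and bnd: "\<And>x u v t. x \<in> X \<Longrightarrow> u < net x \<Longrightarrow> v < net x \<Longrightarrow> t \<in> set (msg x u v) \<Longrightarrow>
      packet_bounded (net x ^ d) t"
  shows "knows (\<lambda>x v. (F x v, \<lambda>u. if u < net x then msg x u v else [])) (\<lambda>x. B x + L x)"
proof -
  obtain A \<beta> where A: "\<And>x. x \<in> X \<Longrightarrow>
      respects_bandwidth A (net x) (inp x) (\<beta> * log 2 (real (net x))) \<and>
      (\<exists>R\<le>B x. halts_at A (net x) (inp x) R (\<lambda>u. (F x u, msg x u, L x)))"
    using assms(1) unfolding knows_def by blast
  define node where "node i = (SOME (n, w). \<exists>x\<in>X. w < net x \<and> inp x w = i \<and> n = net x)" for i
  have node: "node (inp x u) = (net x, u)" if "x \<in> X" "u < net x" for x u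
    unfolding node_def
  proof (rule some_equality)
    show "z = (net x, u)"
      if "case z of (n, w) \<Rightarrow> \<exists>y\<in>X. w < net y \<and> inp y w = inp x u \<and> n = net y" for z
      using that \<open>x \<in> X\<close> \<open>u < net x\<close> inp_eqD by (cases z) (auto; metis)
  qed (use that in auto)
  \<comment> \<open>An algorithm has no state besides its history, so the end of the run of
    \<open>A\<close> is found again in every round, as the shortest prefix on which \<open>A\<close>
    decides.\<close>
  define started where "started i h \<longleftrightarrow> (\<exists>r\<le>length h. decide A i (take r h) \<noteq> None)" for i h
  define start where "start i h = (LEAST r. decide A i (take r h) \<noteq> None)" for i h
  define res where "res i h = the (decide A i (take (start i h) h))" for i h
  \<comment> \<open>Lists shorter than the agreed number of rounds are padded with silence, which
    \<open>decode\<close> drops again.\<close>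
  define slot where "slot ts t = (if t < length ts then encode_packet (ts ! t) else [])"
    for ts :: "packet list" and t
  define decode where "decode ms = map (inv encode_packet) (filter (\<lambda>m. m \<noteq> []) ms)"
    for ms :: "message list"
  have slot_eq: "map (slot ts) [0..<l] = map encode_packet ts @ replicate (l - length ts) []"
    if "length ts \<le> l" for ts l
    using that by (auto simp: slot_def list_eq_iff_nth_eq nth_append)
  have decode_slot: "decode (map (slot ts) [0..<l]) = ts" if "length ts \<le> l" for ts l
    unfolding slot_eq[OF that] decode_def
    by (simp add: filter_map o_def inv_f_f[OF inj_encode_packet])
  \<comment> \<open>The model delivers nothing from a node to itself, so a node copies the list
    addressed to itself from its own output of \<open>A\<close>.\<close>
  define A' :: "('i, 'b \<times> (nat \<Rightarrow> packet list)) cc_algorithm" where "A' = \<lparr>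
      send = (\<lambda>i h w. if started i h
        then (case res i h of (f, ms, l) \<Rightarrow> slot (ms w) (length h - start i h)) else send A i h w),
      decide = (\<lambda>i h. if started i h
        then (case res i h of (f, ms, l) \<Rightarrow> if length h - start i h < l then None
           else Some (f, \<lambda>u. if u < fst (node i) then if u = snd (node i) then ms u
             else decode (map (\<lambda>g. g u) (drop (start i h) h)) else [])) else None)\<rparr>"
  let ?out = "\<lambda>x v. (F x v, \<lambda>u. if u < net x then msg x u v else [])"
  have "respects_bandwidth A' (net x) (inp x)
        (max \<beta> (real (37 * (d + 1) + 1)) * log 2 (real (net x))) \<and>
      (\<exists>R'\<le>B x + L x. halts_at A' (net x) (inp x) R' (?out x))" if x: "x \<in> X" for x
  proof -
    let ?n = "net x" and ?i = "inp x"
    obtain R where R: "R \<le> B x" "halts_at A ?n ?i R (\<lambda>u. (F x u, msg x u, L x))"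
      using A[OF x] by blast
    define hA where "hA r v = histories A ?n ?i r v" for r v
    define h' where "h' r v = histories A' ?n ?i r v" for r v
    have lenA: "length (hA r v) = r" if "v < ?n" "r \<le> R" for r v
      unfolding hA_def by (rule length_histories[OF R(2) that])
    have takeA: "take r (hA r' v) = hA r v" if "v < ?n" "r \<le> r'" "r' \<le> R" for r r' v
      unfolding hA_def by (rule take_histories[OF R(2) that])
    have decA: "decide A (?i v) (hA r v) = None" if "v < ?n" "r < R" for r v
      using R(2) that by (auto simp: halts_at_def node_output_def hA_def)
    have decAR: "decide A (?i v) (hA R v) = Some (F x v, msg x v, L x)" if "v < ?n" for v
      using R(2) that by (auto simp: halts_at_def node_output_def hA_def)
    have not_started: "\<not> started (?i v) (hA r v)" if "v < ?n" "r < R" for r v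
      unfolding started_def using that lenA[of v r] takeA[of v _ r] decA[of v] by auto
    \<comment> \<open>Whatever is appended after round \<open>R\<close>, the prefix of length
      \<open>R\<close> is the first on which \<open>A\<close> decides, so its output remains
      readable throughout the exchange.\<close>
    have after: "started (?i v) (hA R v @ g)" "start (?i v) (hA R v @ g) = R"
      "res (?i v) (hA R v @ g) = (F x v, msg x v, L x)" if v: "v < ?n" for v g
    proof -
      have *: "take r (hA R v @ g) = hA r v" if "r \<le> R" for r
        using takeA[OF v that] lenA[OF v] that by simp
      show "started (?i v) (hA R v @ g)"
        unfolding started_def using *[of R] decAR[OF v] lenA[OF v, of R] by (intro exI[of _ R]) auto
      show st: "start (?i v) (hA R v @ g) = R"
        unfolding start_def
      proof (rule Least_equality)
        show "R \<le> r" if "decide A (?i v) (take r (hA R v @ g)) \<noteq> None" for r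
          using that *[of r] decA[OF v, of r] by (cases "r < R") auto
      qed (use *[of R] decAR[OF v] in simp)
      show "res (?i v) (hA R v @ g) = (F x v, msg x v, L x)"
        unfolding res_def st using *[of R] decAR[OF v] by simp
    qed
    have before_eq: "h' r v = hA r v" if "r \<le> R" "v < ?n" for r v
      using that
    proof (induction r arbitrary: v)
      case 0
      then show ?case by (simp add: h'_def hA_def)
    next
      case (Suc r)
      have eq: "h' r u = hA r u" if "u < ?n" for u
        using Suc that by simp
      have "decide A' (?i v) (h' r v) = None"
        using eq Suc.prems not_started[of v r] by (simp add: A'_def)
      moreover have "outgoing A' ?n ?i (h' r) u v = outgoing A ?n ?i (hA r) u v" for u
        using eq Suc.prems not_started[of u r] decA[of u r]
        by (simp add: outgoing_def A'_def)
      ultimately show ?case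
        using Suc.prems eq[of v] decA[of v r]
          histories_Suc_running[of A' ?i v ?n r] histories_Suc_running[of A ?i v ?n r]
        by (simp add: h'_def[abs_def] hA_def[abs_def])
    qed
    define phase where
      "phase k v = map (\<lambda>t u. if u < ?n \<and> u \<noteq> v then slot (msg x u v) t else []) [0..<k]" for k v
    have after_eq: "h' (R + k) v = hA R v @ phase k v" if "k \<le> L x" "v < ?n" for k v
      using that
    proof (induction k arbitrary: v)
      case 0
      then show ?case by (simp add: phase_def before_eq)
    next
      case (Suc k)
      have eq: "h' (R + k) u = hA R u @ phase k u" if "u < ?n" for u
        using Suc that by simp
      have len': "length (h' (R + k) u) = R + k" if "u < ?n" for u
        using eq[OF that] lenA[of u R] that by (simp add: phase_def)
      have dec: "decide A' (?i u) (h' (R + k) u) = None" if "u < ?n" for u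
        using len'[OF that] Suc.prems that unfolding eq[OF that]
        by (simp add: A'_def after)
      have "send A' (?i u) (h' (R + k) u) v = slot (msg x u v) k" if "u < ?n" for u
        using len'[OF that] that unfolding eq[OF that] by (simp add: A'_def after)
      then have "outgoing A' ?n ?i (h' (R + k)) u v
          = (if u < ?n \<and> u \<noteq> v then slot (msg x u v) k else [])" for u
        using dec Suc.prems by (simp add: outgoing_def)
      moreover have "h' (Suc (R + k)) v
          = h' (R + k) v @ [\<lambda>u. outgoing A' ?n ?i (h' (R + k)) u v]"
        using histories_Suc_running[of A' ?i v ?n "R + k"] dec[of v] Suc.prems
        by (simp add: h'_def[abs_def])
      ultimately show ?case
        using eq[of v] Suc.prems by (simp add: phase_def)
    qed
    have len': "length (hA R v @ phase k v) = R + k" if "v < ?n" for v k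
      using lenA[of v R] that by (simp add: phase_def)
    have halts: "halts_at A' ?n ?i (R + L x) (?out x)"
      unfolding halts_at_def node_output_def h'_def[symmetric]
    proof (intro allI impI conjI)
      fix v r assume v: "v < ?n" and r: "r < R + L x"
      show "decide A' (?i v) (h' r v) = None"
      proof (cases "r < R")
        case True
        then show ?thesis
          using before_eq[of r v] not_started[of v r] v by (simp add: A'_def)
      next
        case False
        then obtain k where k: "r = R + k" using le_Suc_ex not_less by blast
        then show ?thesis
          using after_eq[of k v] v r len'[of v k] by (simp add: A'_def after)
      qed
    next
      fix v assume v: "v < ?n"
      have "map (\<lambda>g. g u) (phase (L x) v) = map (slot (msg x u v)) [0..<L x]"
        if "u < ?n" "u \<noteq> v" for u
        using that by (simp add: phase_def o_def)
      then have "decode (map (\<lambda>g. g u) (phase (L x) v)) = msg x u v" if "u < ?n" "u \<noteq> v" for u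
        using that v x len by (simp add: decode_slot)
      then show "decide A' (?i v) (h' (R + L x) v) = Some (?out x v)"
        using after_eq[of "L x" v] v len'[of v "L x"] lenA[of v R]
        by (auto simp: A'_def after node[OF x v] fun_eq_iff)
    qed
    moreover have "respects_bandwidth A' ?n ?i (max \<beta> (real (37 * (d + 1) + 1)) * log 2 (real ?n))"
      unfolding respects_bandwidth_def
    proof (intro allI)
      fix r u v
      let ?c = "real (37 * (d + 1) + 1)" and ?l = "log 2 (real ?n)"
      have l: "?l \<ge> 0" using net_ge_2[OF x] by simp
      show "real (length (outgoing A' ?n ?i (histories A' ?n ?i r) u v)) \<le> max \<beta> ?c * ?l"
      proof (cases "u < ?n \<and> v < ?n \<and> u \<noteq> v \<and> r < R + L x")
        case False
        then have "outgoing A' ?n ?i (histories A' ?n ?i r) u v = []"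
          using halted_stays[OF halts, of u r] by (auto simp: outgoing_def)
        then show ?thesis using l by (simp add: max_def)
      next
        case True
        show ?thesis
        proof (cases "r < R")
          case less: True
          have "outgoing A' ?n ?i (h' r) u v = outgoing A ?n ?i (hA r) u v"
            using True less before_eq[of r u] not_started[of u r] decA[of u r]
            by (simp add: outgoing_def A'_def)
          moreover have "real (length (outgoing A ?n ?i (hA r) u v)) \<le> \<beta> * ?l"
            using A[OF x] by (simp add: respects_bandwidth_def hA_def[abs_def])
          ultimately show ?thesis
            using mult_right_mono[OF max.cobounded1[of \<beta> ?c] l] by (simp add: h'_def[abs_def])
        next
          case False
          then obtain k where k: "r = R + k" using le_Suc_ex not_less by blast
          have "outgoing A' ?n ?i (h' r) u v = slot (msg x u v) k"
            using True k after_eq[of k u] len'[of u k] by (simp add: outgoing_def A'_def after)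
          moreover have "real (length (slot (msg x u v) k)) \<le> ?c * ?l"
            using True bnd[OF x, of u v "msg x u v ! k"] net_ge_2[OF x] l
              length_encode_packet_le[of ?n d "msg x u v ! k"]
            by (auto simp: slot_def)
          ultimately show ?thesis
            using mult_right_mono[OF max.cobounded2[of ?c \<beta>] l] by (simp add: h'_def[abs_def])
        qed
      qed
    qed
    ultimately show ?thesis
      using R(1) by (intro conjI exI[of _ "R + L x"]) auto
  qed
  then show ?thesis unfolding knows_def by blast
qed

text \<open>The number of rounds of a phase is agreed upon in one round beforehand.\<close>

lemma knows_stage:
  assumes "knows (\<lambda>x u. (F x u, msg x u)) B"
    and len: "\<And>x u v. x \<in> X \<Longrightarrow> u < net x \<Longrightarrow> v < net x \<Longrightarrow> length (msg x u v) \<le> L x"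
    and L: "\<And>x. x \<in> X \<Longrightarrow> L x \<le> net x ^ d"
    and bnd: "\<And>x u v t. x \<in> X \<Longrightarrow> u < net x \<Longrightarrow> v < net x \<Longrightarrow> t \<in> set (msg x u v) \<Longrightarrow>
      packet_bounded (net x ^ d) t"
  shows "knows (\<lambda>x v. (F x v, \<lambda>u. if u < net x then msg x u v else [])) (\<lambda>x. B x + 1 + L x)"
proof -
  define mx where "mx x u = Max ((\<lambda>v. length (msg x u v)) ` {..<net x})" for x u
  \<comment> \<open>The phase lasts for the true maximum \<open>M x\<close>, which all nodes can
    compute once each has broadcast its own maximum; the bound \<open>L x\<close> may remain unknown
    to them.\<close>
  define M where "M x = Max (mx x ` {..<net x})" for x
  have ne: "{..<net x} \<noteq> {}" if "x \<in> X" for x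
    using net_ge_2[OF that] by (auto simp: lessThan_empty_iff)
  have mx_le: "mx x u \<le> L x" if "x \<in> X" "u < net x" for x u
    unfolding mx_def using that ne[OF that(1)] len by (subst Max_le_iff) auto
  have M_le: "M x \<le> L x" if "x \<in> X" for x
    unfolding M_def using that ne[OF that(1)] mx_le by (subst Max_le_iff) auto
  have le_M: "length (msg x u v) \<le> M x" if "x \<in> X" "u < net x" "v < net x" for x u v
  proof -
    have "length (msg x u v) \<le> mx x u"
      unfolding mx_def using that by (intro Max_ge) auto
    also have "\<dots> \<le> M x"
      unfolding M_def using that by (intro Max_ge) auto
    finally show ?thesis .
  qed
  have "knows (\<lambda>x u. ((F x u, msg x u), \<lambda>v. [(mx x u, 0, 0)] :: packet list, 1 :: nat)) B"
    by (rule knows_determined[OF assms(1)]) (auto simp: mx_def)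
  then have "knows (\<lambda>x v. ((F x v, msg x v), \<lambda>u. if u < net x then [(mx x u, 0, 0)] else [] :: packet list))
      (\<lambda>x. B x + 1)"
    by (rule knows_exchange[where d = d and L = "\<lambda>x. 1"])
      (use mx_le L in \<open>auto simp: packet_bounded_def intro: order.trans\<close>)
  then have "knows (\<lambda>x v. (F x v, msg x v, M x)) (\<lambda>x. B x + 1)"
  proof (rule knows_determined)
    fix x y u
    assume "net y = net x" and eq: "((F x u, msg x u), \<lambda>v. if v < net x then [(mx x v, 0, 0)] else [] :: packet list) =
      ((F y u, msg y u), \<lambda>v. if v < net y then [(mx y v, 0, 0)] else [] :: packet list)"
    then have "mx x v = mx y v" if "v < net x" for v
      using that by (auto simp: fun_eq_iff dest: spec[of _ v])
    then have "mx x ` {..<net x} = mx y ` {..<net x}"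
      by (intro image_cong) auto
    then have "M x = M y"
      using \<open>net y = net x\<close> by (simp add: M_def)
    with eq show "(F x u, msg x u, M x) = (F y u, msg y u, M y)" by simp
  qed
  then have "knows (\<lambda>x v. (F x v, \<lambda>u. if u < net x then msg x u v else [])) (\<lambda>x. B x + 1 + M x)"
    by (rule knows_exchange) (use le_M bnd in auto)
  then show ?thesis
    by (rule knows_mono) (use M_le in auto)
qed

end

section \<open>Balanced colourings\<close>

text \<open>Markov's inequality: with D elements in the class of \<open>a\<close>, fewer than half
  of the n colours can exceed twice the average D / n. Scaling by n avoids division.\<close>

lemma few_overused_colours:
  assumes "finite M" "n > 0" "S \<subseteq> M"
  shows "2 * card {y. y < n \<and> 2 * card {m\<in>M. h m = a} < n * card {m\<in>S. h m = a \<and> \<phi> m = y}} < n"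
proof (rule ccontr)
  define D where "D = card {m\<in>M. h m = a}"
  define l where "l y = card {m\<in>S. h m = a \<and> \<phi> m = y}" for y
  define Y where "Y = {y. y < n \<and> 2 * D < n * l y}"
  assume "\<not> ?thesis"
  then have Y: "n \<le> 2 * card Y"
    by (simp add: Y_def D_def l_def)
  then have "Y \<noteq> {}" using assms(2) by auto
  have fin: "finite Y" by (simp add: Y_def)
  have finS: "finite S" using assms finite_subset by blast
  have "(\<Sum>y\<in>Y. l y) = card (\<Union>y\<in>Y. {m\<in>S. h m = a \<and> \<phi> m = y})"
    unfolding l_def using fin finS by (subst card_UN_disjoint) auto
  also have "\<dots> \<le> D"
    unfolding D_def using assms by (intro card_mono) auto
  finally have "n * (\<Sum>y\<in>Y. l y) \<le> n * D" by simp
  also have "n * D \<le> (\<Sum>y\<in>Y. 2 * D)"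
    using mult_right_mono[OF Y, of D] by (simp add: ac_simps)
  also have "(\<Sum>y\<in>Y. 2 * D) < (\<Sum>y\<in>Y. n * l y)"
    using fin \<open>Y \<noteq> {}\<close> by (intro sum_strict_mono) (auto simp: Y_def)
  finally show False by (simp flip: sum_distrib_left)
qed

text \<open>The summand \<open>+ n\<close> pays for the one element just coloured: before this step
  its colour was used at most 2 D / n times in its class.\<close>

lemma colouring_step:
  assumes "finite S" "m \<notin> S"
    and old: "\<And>a z. n * card {k\<in>S. h k = a \<and> \<phi> k = z} \<le> 2 * D a + n"
    and free: "n * card {k\<in>S. h k = h m \<and> \<phi> k = y} \<le> 2 * D (h m)"
  shows "n * card {k\<in>insert m S. h k = a \<and> (\<phi>(m := y)) k = z} \<le> 2 * D a + n"
proof (cases "h m = a \<and> z = y")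
  case True
  then have "{k\<in>insert m S. h k = a \<and> (\<phi>(m := y)) k = z} = insert m {k\<in>S. h k = a \<and> \<phi> k = y}"
    using assms(2) by auto
  then show ?thesis
    using True free assms by simp
next
  case False
  then have "{k\<in>insert m S. h k = a \<and> (\<phi>(m := y)) k = z} = {k\<in>S. h k = a \<and> \<phi> k = z}"
    using assms(2) by auto
  then show ?thesis using old by simp
qed

text \<open>\<open>M\<close> is the edge set of a bipartite multigraph with ends \<open>f m\<close>
  and \<open>g m\<close>. By \<open>few_overused_colours\<close> each end of the next edge rules out
  fewer than half of the colours, so one colour is acceptable at both ends. The factor 2 is the
  price for replacing an optimal edge colouring by a greedy one.\<close>

lemma greedy_colouring:
  fixes f :: "'m \<Rightarrow> 'a" and g :: "'m \<Rightarrow> 'b"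
  assumes "finite M" "n > 0"
  obtains \<phi> :: "'m \<Rightarrow> nat" where "\<And>m. \<phi> m < n"
    and "\<And>a y. n * card {m\<in>M. f m = a \<and> \<phi> m = y} \<le> 2 * card {m\<in>M. f m = a} + n"
    and "\<And>b y. n * card {m\<in>M. g m = b \<and> \<phi> m = y} \<le> 2 * card {m\<in>M. g m = b} + n"
proof -
  have "\<exists>\<phi>. (\<forall>m. \<phi> m < n) \<and>
      (\<forall>a y. n * card {m\<in>S. f m = a \<and> \<phi> m = y} \<le> 2 * card {m\<in>M. f m = a} + n) \<and>
      (\<forall>b y. n * card {m\<in>S. g m = b \<and> \<phi> m = y} \<le> 2 * card {m\<in>M. g m = b} + n)"
    if "S \<subseteq> M" for S
    using finite_subset[OF that assms(1)] that
  proof (induction S rule: finite_induct)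
    case empty
    then show ?case using assms(2) by (intro exI[of _ "\<lambda>_. 0"]) auto
  next
    case (insert m S)
    then obtain \<phi> :: "'m \<Rightarrow> nat" where \<phi>: "\<And>m. \<phi> m < n"
      "\<And>a y. n * card {m\<in>S. f m = a \<and> \<phi> m = y} \<le> 2 * card {m\<in>M. f m = a} + n"
      "\<And>b y. n * card {m\<in>S. g m = b \<and> \<phi> m = y} \<le> 2 * card {m\<in>M. g m = b} + n"
      by auto
    define P where
      "P = {y. y < n \<and> 2 * card {k\<in>M. f k = f m} < n * card {k\<in>S. f k = f m \<and> \<phi> k = y}}"
    define Q where
      "Q = {y. y < n \<and> 2 * card {k\<in>M. g k = g m} < n * card {k\<in>S. g k = g m \<and> \<phi> k = y}}"
    have "2 * card P < n" "2 * card Q < n"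
      unfolding P_def Q_def using few_overused_colours[OF assms] insert.prems by auto
    then have "card (P \<union> Q) < card {..<n}"
      using card_Un_le[of P Q] by simp
    moreover have "finite (P \<union> Q)" by (simp add: P_def Q_def)
    ultimately obtain y where y: "y < n" "y \<notin> P" "y \<notin> Q"
      by (metis UnCI card_mono lessThan_iff linorder_not_less subsetI)
    have "n * card {k\<in>insert m S. f k = a \<and> (\<phi>(m := y)) k = z} \<le> 2 * card {k\<in>M. f k = a} + n" for a z
      using insert.hyps \<phi> y by (intro colouring_step) (auto simp: P_def not_less)
    moreover have "n * card {k\<in>insert m S. g k = b \<and> (\<phi>(m := y)) k = z} \<le> 2 * card {k\<in>M. g k = b} + n" for b z
      using insert.hyps \<phi> y by (intro colouring_step) (auto simp: Q_def not_less)
    moreover have "(\<phi>(m := y)) k < n" for k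
      using y(1) \<phi>(1) by simp
    ultimately show ?case by blast
  qed
  from this[of M] show ?thesis using that by auto
qed

text \<open>\<open>c u b\<close> counts the messages from \<open>u\<close> to \<open>b\<close>, and the \<open>i\<close>-th of them gets the colour
  \<open>balanced n c u b i\<close>.\<close>

definition is_balanced :: "nat \<Rightarrow> (nat \<Rightarrow> nat \<Rightarrow> nat) \<Rightarrow> (nat \<Rightarrow> nat \<Rightarrow> nat \<Rightarrow> nat) \<Rightarrow> bool" where
  "is_balanced n c \<phi> \<longleftrightarrow> (\<forall>u b i. \<phi> u b i < n) \<and>
     (\<forall>u<n. \<forall>y. n * (\<Sum>b<n. card {i. i < c u b \<and> \<phi> u b i = y}) \<le> 2 * (\<Sum>b<n. c u b) + n) \<and>
     (\<forall>b<n. \<forall>y. n * (\<Sum>u<n. card {i. i < c u b \<and> \<phi> u b i = y}) \<le> 2 * (\<Sum>u<n. c u b) + n)"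

text \<open>A fixed choice that depends on the counts alone: nodes that know the same
  \<open>c\<close> agree on the colouring without communication.\<close>

definition balanced :: "nat \<Rightarrow> (nat \<Rightarrow> nat \<Rightarrow> nat) \<Rightarrow> nat \<Rightarrow> nat \<Rightarrow> nat \<Rightarrow> nat" where
  "balanced n c = (SOME \<phi>. is_balanced n c \<phi>)"

lemma
  assumes "n > 0"
  shows balanced_less: "balanced n c u b i < n"
    and balanced_source: "u < n \<Longrightarrow>
      n * (\<Sum>b<n. card {i. i < c u b \<and> balanced n c u b i = y}) \<le> 2 * (\<Sum>b<n. c u b) + n"
    and balanced_target: "b < n \<Longrightarrow>
      n * (\<Sum>u<n. card {i. i < c u b \<and> balanced n c u b i = y}) \<le> 2 * (\<Sum>u<n. c u b) + n"
proof -
  define M where "M = (SIGMA u:{..<n}. SIGMA b:{..<n}. {..<c u b})"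
  have "finite M" by (auto simp: M_def)
  then obtain \<phi>' where \<phi>': "\<And>m. \<phi>' m < n"
    "\<And>u y. n * card {m\<in>M. fst m = u \<and> \<phi>' m = y} \<le> 2 * card {m\<in>M. fst m = u} + n"
    "\<And>b y. n * card {m\<in>M. fst (snd m) = b \<and> \<phi>' m = y} \<le> 2 * card {m\<in>M. fst (snd m) = b} + n"
    using greedy_colouring[OF _ assms, of M fst "\<lambda>m. fst (snd m)"] by blast
  define \<phi> where "\<phi> u b i = \<phi>' (u, b, i)" for u b i
  have 1: "card {m\<in>M. fst m = u \<and> Q m} = (\<Sum>b<n. card {i. i < c u b \<and> Q (u, b, i)})"
    if "u < n" for u and Q :: "nat \<times> nat \<times> nat \<Rightarrow> bool"
  proof -
    have "{m\<in>M. fst m = u \<and> Q m} = Pair u ` (SIGMA b:{..<n}. {i. i < c u b \<and> Q (u, b, i)})"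
      using that by (auto simp: M_def)
    then show ?thesis by (simp add: card_image inj_on_def card_SigmaI)
  qed
  have 2: "card {m\<in>M. fst (snd m) = b \<and> Q m} = (\<Sum>u<n. card {i. i < c u b \<and> Q (u, b, i)})"
    if "b < n" for b and Q :: "nat \<times> nat \<times> nat \<Rightarrow> bool"
  proof -
    have "{m\<in>M. fst (snd m) = b \<and> Q m}
        = (\<lambda>(u, i). (u, b, i)) ` (SIGMA u:{..<n}. {i. i < c u b \<and> Q (u, b, i)})"
      using that by (auto simp: M_def)
    then show ?thesis by (simp add: card_image inj_on_def card_SigmaI split: prod.splits)
  qed
  have 3: "n * (\<Sum>b<n. card {i. i < c u b \<and> \<phi> u b i = y}) \<le> 2 * (\<Sum>b<n. c u b) + n"
    if "u < n" for u y
    using \<phi>'(2)[of u y] 1[OF that, of "\<lambda>m. \<phi>' m = y"] 1[OF that, of "\<lambda>m. True"]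
    by (simp add: \<phi>_def)
  have 4: "n * (\<Sum>u<n. card {i. i < c u b \<and> \<phi> u b i = y}) \<le> 2 * (\<Sum>u<n. c u b) + n"
    if "b < n" for b y
    using \<phi>'(3)[of b y] 2[OF that, of "\<lambda>m. \<phi>' m = y"] 2[OF that, of "\<lambda>m. True"]
    by (simp add: \<phi>_def)
  have "is_balanced n c \<phi>"
    unfolding is_balanced_def using 3 4 \<phi>'(1) by (simp add: \<phi>_def)
  then have *: "is_balanced n c (balanced n c)"
    unfolding balanced_def by (rule someI[of "is_balanced n c"])
  show "balanced n c u b i < n"
    using * by (simp add: is_balanced_def)
  show "u < n \<Longrightarrow>
      n * (\<Sum>b<n. card {i. i < c u b \<and> balanced n c u b i = y}) \<le> 2 * (\<Sum>b<n. c u b) + n"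
    using * by (simp add: is_balanced_def)
  show "b < n \<Longrightarrow>
      n * (\<Sum>u<n. card {i. i < c u b \<and> balanced n c u b i = y}) \<le> 2 * (\<Sum>u<n. c u b) + n"
    using * by (simp add: is_balanced_def)
qed

section \<open>Splitting lists of messages by colour\<close>

definition count_class :: "('t \<Rightarrow> nat) \<Rightarrow> 't list \<Rightarrow> nat \<Rightarrow> nat" where
  "count_class cls ts b = length (filter (\<lambda>t. cls t = b) ts)"

text \<open>The sublist of colour \<open>y\<close>, where the \<open>i\<close>-th message of class
  \<open>b\<close> has colour \<open>\<phi> b i\<close>. Colours are attached to ranks within a
  class and not to messages, so all loads are determined by class counts, which are cheap to
  share.\<close>

definition spread :: "nat \<Rightarrow> ('t \<Rightarrow> nat) \<Rightarrow> 't list \<Rightarrow> (nat \<Rightarrow> nat \<Rightarrow> nat) \<Rightarrow> nat \<Rightarrow> 't list" where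
  "spread N cls ts \<phi> y = concat (map (\<lambda>b. map ((!) (filter (\<lambda>t. cls t = b) ts))
     (filter (\<lambda>i. \<phi> b i = y) [0..<count_class cls ts b])) [0..<N])"

lemma length_filter_upt: "length (filter P [0..<n]) = card {i. i < n \<and> P i}"
  by (simp add: length_filter_conv_card cong: conj_cong)

lemma length_spread:
  "length (spread N cls ts \<phi> y) = (\<Sum>b<N. card {i. i < count_class cls ts b \<and> \<phi> b i = y})"
  by (simp add: spread_def length_concat o_def length_filter_upt interv_sum_list_conv_sum_set_nat
      atLeast0LessThan)

lemma set_spread: "set (spread N cls ts \<phi> y) \<subseteq> set ts"
  unfolding spread_def by (fastforce simp: count_class_def dest: nth_mem)

lemma count_class_spread:
  assumes "b < N"
  shows "count_class cls (spread N cls ts \<phi> y) b = card {i. i < count_class cls ts b \<and> \<phi> b i = y}"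
proof -
  let ?f = "\<lambda>b. map ((!) (filter (\<lambda>t. cls t = b) ts))
     (filter (\<lambda>i. \<phi> b i = y) [0..<count_class cls ts b])"
  have cls: "cls t = b'" if t: "t \<in> set (?f b')" for t b'
  proof -
    obtain i where "i < count_class cls ts b'" "t = filter (\<lambda>t. cls t = b') ts ! i"
      using t by auto
    then have "t \<in> set (filter (\<lambda>t. cls t = b') ts)"
      unfolding count_class_def by (metis nth_mem)
    then show ?thesis by simp
  qed
  have eq: "count_class cls (?f b') b = (if b' = b then length (?f b) else 0)" for b'
  proof (cases "b' = b")
    case True
    then have "filter (\<lambda>t. cls t = b) (?f b') = ?f b'"
      using cls[of _ b'] by (intro filter_True) blast
    with True show ?thesis by (simp only: count_class_def simp_thms if_True)
  next
    case False
    then have "filter (\<lambda>t. cls t = b) (?f b') = []"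
      using cls[of _ b'] by (intro filter_False) blast
    with False show ?thesis by (simp only: count_class_def simp_thms if_False list.size)
  qed
  have "count_class cls (spread N cls ts \<phi> y) b = (\<Sum>b'<N. count_class cls (?f b') b)"
    unfolding spread_def count_class_def[of cls "concat _"] count_class_def[of cls "map _ _"]
    by (simp add: filter_concat length_concat o_def
        interv_sum_list_conv_sum_set_nat atLeast0LessThan)
  also have "\<dots> = (\<Sum>b'<N. if b' = b then length (?f b) else 0)"
    by (simp only: eq)
  also have "\<dots> = card {i. i < count_class cls ts b \<and> \<phi> b i = y}"
    using assms by (simp add: length_filter_upt)
  finally show ?thesis .
qed

text \<open>Each rank has exactly one colour below \<open>n\<close>, so nothing is lost or
  duplicated. Multisets are used because the load at the targets must be preserved, not only the set
  of messages.\<close>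

lemma mset_spread:
  assumes "\<And>t. t \<in> set ts \<Longrightarrow> cls t < N" "\<And>b i. \<phi> b i < n"
  shows "(\<Sum>y<n. mset (spread N cls ts \<phi> y)) = mset ts"
proof -
  let ?fs = "\<lambda>b. filter (\<lambda>t. cls t = b) ts"
  have img: "image_mset f (\<Sum>y<n. g y) = (\<Sum>y<n. image_mset f (g y))"
    for f :: "nat \<Rightarrow> 'a" and g
    by (induction n) auto
  have "(\<Sum>y<n. mset (spread N cls ts \<phi> y))
      = (\<Sum>y<n. \<Sum>b<N. image_mset ((!) (?fs b)) (filter_mset (\<lambda>i. \<phi> b i = y) (mset [0..<length (?fs b)])))"
    by (simp add: spread_def count_class_def mset_concat o_def interv_sum_list_conv_sum_set_nat
        atLeast0LessThan del: mset_upt)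
  also have "\<dots> = (\<Sum>b<N. image_mset ((!) (?fs b)) (\<Sum>y<n. filter_mset (\<lambda>i. \<phi> b i = y) (mset [0..<length (?fs b)])))"
    by (subst sum.swap) (simp only: img)
  also have "\<dots> = (\<Sum>b<N. mset (?fs b))"
  proof (intro sum.cong refl)
    fix b
    have split: "(\<Sum>y<n. filter_mset (\<lambda>i. \<phi> b i = y) A) = A" for A
    proof (induction A)
      case (add k A)
      have "(\<Sum>y<n. filter_mset (\<lambda>i. \<phi> b i = y) (add_mset k A))
          = (\<Sum>y<n. (if y = \<phi> b k then {#k#} else {#}) + filter_mset (\<lambda>i. \<phi> b i = y) A)"
        by (intro sum.cong) auto
      also have "\<dots> = add_mset k A"
        using assms(2)[of b k] add by (simp add: sum.distrib)
      finally show ?case .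
    qed simp
    show "image_mset ((!) (?fs b)) (\<Sum>y<n. filter_mset (\<lambda>i. \<phi> b i = y) (mset [0..<length (?fs b)]))
        = mset (?fs b)"
      unfolding split by (simp only: map_nth flip: mset_map)
  qed
  also have "\<dots> = mset ts"
    using assms(1)
  proof (induction ts)
    case (Cons t ts)
    have "(\<Sum>b<N. mset (filter (\<lambda>t. cls t = b) (t # ts)))
        = (\<Sum>b<N. (if b = cls t then {#t#} else {#}) + mset (filter (\<lambda>t. cls t = b) ts))"
      by (intro sum.cong) auto
    also have "\<dots> = mset (t # ts)"
      using Cons by (simp add: sum.distrib)
    finally show ?case .
  qed simp
  finally show ?thesis .
qed

section \<open>Routing\<close>

abbreviation target :: "packet \<Rightarrow> nat" where
  "target t \<equiv> snd (snd t)"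

lemma packet_bounded_mono: "packet_bounded M t \<Longrightarrow> M \<le> N \<Longrightarrow> packet_bounded N t"
  by (auto simp: packet_bounded_def)

lemma set_spread_UN:
  assumes "\<And>t. t \<in> set ts \<Longrightarrow> cls t < N" "\<And>b i. \<phi> b i < n"
  shows "(\<Union>y<n. set (spread N cls ts \<phi> y)) = set ts"
  using arg_cong[OF mset_spread[OF assms], where f = set_mset] by (simp add: set_mset_sum)

lemma sum_list_upt: "sum_list (map f [0..<n]) = (\<Sum>i<n. f i)"
  by (simp add: interv_sum_list_conv_sum_set_nat atLeast0LessThan)

lemma count_class_concat:
  "count_class cls (concat (map f [0..<n])) b = (\<Sum>u<n. count_class cls (f u) b)"
  by (simp add: count_class_def filter_concat length_concat o_def sum_list_upt)

lemma sum_count_class: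
  assumes "finite B" "\<And>t. t \<in> set ts \<Longrightarrow> P t \<longleftrightarrow> cls t \<in> B"
  shows "(\<Sum>b\<in>B. count_class cls ts b) = length (filter P ts)"
  using assms(2)
proof (induction ts)
  case (Cons t ts)
  have "(\<Sum>b\<in>B. count_class cls (t # ts) b)
      = (\<Sum>b\<in>B. (if cls t = b then 1 else 0) + count_class cls ts b)"
    by (intro sum.cong) (auto simp: count_class_def)
  also have "\<dots> = length (filter P (t # ts))"
    using Cons assms(1) by (simp add: sum.distrib)
  finally show ?case .
qed (simp add: count_class_def)

lemma count_class_le_length: "count_class cls ts b \<le> length ts"
  by (simp add: count_class_def)

text \<open>Turns the guarantee of a balanced colouring into a load per link: a total of n * K over
  n colours leaves at most 2 K + 1 for each.\<close>

lemma le_of_scaled: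
  assumes "n * a \<le> 2 * D + n" "D \<le> n * K" "(n::nat) > 0"
  shows "a \<le> 2 * K + 1"
proof -
  have "n * a \<le> n * (2 * K + 1)"
    using assms(1,2) by (simp add: algebra_simps)
  then show ?thesis using assms(3) by (metis nat_mult_le_cancel1)
qed

section \<open>Routing through intermediate nodes\<close>

context clique_inputs
begin

text \<open>The colour of a message is the intermediate node it travels through. The assumption
  \<open>out\<close> bounds the load of the link from \<open>u\<close> to \<open>y\<close>, and
  \<open>into\<close> that of the link from \<open>y\<close> to \<open>v\<close>; hence two stages
  of 1 + L rounds. Each sender only has to know the colours of its own messages.\<close>

lemma knows_two_hop:
  assumes start: "knows (\<lambda>x u. (F x u, ms x u, \<phi> x u)) B"
    and rng: "\<And>x u b i. x \<in> X \<Longrightarrow> u < net x \<Longrightarrow> \<phi> x u b i < net x"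
    and bnd: "\<And>x u t. x \<in> X \<Longrightarrow> u < net x \<Longrightarrow> t \<in> set (ms x u) \<Longrightarrow>
      packet_bounded (net x ^ d) t \<and> target t < net x"
    and out: "\<And>x u y. x \<in> X \<Longrightarrow> u < net x \<Longrightarrow> y < net x \<Longrightarrow>
      (\<Sum>b<net x. card {i. i < count_class target (ms x u) b \<and> \<phi> x u b i = y}) \<le> L x"
    and into: "\<And>x v y. x \<in> X \<Longrightarrow> v < net x \<Longrightarrow> y < net x \<Longrightarrow>
      (\<Sum>u<net x. card {i. i < count_class target (ms x u) v \<and> \<phi> x u v i = y}) \<le> L x"
    and L: "\<And>x. x \<in> X \<Longrightarrow> L x \<le> net x ^ d"
  shows "knows (\<lambda>x v. (F x v, {(a, b). \<exists>u<net x. (a, b, v) \<in> set (ms x u)})) (\<lambda>x. B x + 2 + 2 * L x)"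
proof -
  define m1 where "m1 x u = spread (net x) target (ms x u) (\<phi> x u)" for x u
  define m2 where
    "m2 x y v = filter (\<lambda>t. target t = v) (concat (map (\<lambda>u. m1 x u y) [0..<net x]))" for x y v
  have bnd1: "packet_bounded (net x ^ d) t" if "x \<in> X" "u < net x" "t \<in> set (m1 x u y)" for x u y t
    using bnd[of x u t] that set_spread by (fastforce simp: m1_def)
  have "knows (\<lambda>x u. (F x u, m1 x u)) B"
    by (rule knows_determined[OF start]) (simp add: m1_def)
  then have "knows (\<lambda>x y. (F x y, \<lambda>u. if u < net x then m1 x u y else [])) (\<lambda>x. B x + 1 + L x)"
    by (rule knows_stage[where d = d])
      (use out L bnd1 in \<open>auto simp: m1_def length_spread\<close>)
  then have "knows (\<lambda>x y. (F x y, m2 x y)) (\<lambda>x. B x + 1 + L x)"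
  proof (rule knows_determined)
    fix x y v
    assume n: "net y = net x" and "(F x v, \<lambda>u. if u < net x then m1 x u v else [])
      = (F y v, \<lambda>u. if u < net y then m1 y u v else [])"
    then have "F x v = F y v" and eq: "\<And>u. u < net x \<Longrightarrow> m1 x u v = m1 y u v"
      by (auto simp: fun_eq_iff) (metis+)
    then show "(F x v, m2 x v) = (F y v, m2 y v)"
      using n by (auto simp: m2_def fun_eq_iff intro!: arg_cong[where f = concat] arg_cong[where f = "filter _"])
  qed
  then have "knows (\<lambda>x v. (F x v, \<lambda>y. if y < net x then m2 x y v else [])) (\<lambda>x. (B x + 1 + L x) + 1 + L x)"
  proof (rule knows_stage[where d = d])
    fix x y v assume *: "x \<in> X" "y < net x" "v < net x"
    have "length (m2 x y v) = (\<Sum>u<net x. count_class target (m1 x u y) v)"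
      by (simp add: m2_def flip: count_class_concat count_class_def)
    then show "length (m2 x y v) \<le> L x"
      using into[of x v y] * by (simp add: m1_def count_class_spread)
  qed (use L bnd1 in \<open>auto simp: m2_def\<close>)
  then have "knows (\<lambda>x v. (F x v, {(a, b). \<exists>u<net x. (a, b, v) \<in> set (ms x u)}))
      (\<lambda>x. (B x + 1 + L x) + 1 + L x)"
  proof (rule knows_determined)
    fix x y v
    assume xy: "x \<in> X" "y \<in> X" and n: "net y = net x" and v: "v < net x"
      and "(F x v, \<lambda>u. if u < net x then m2 x u v else [])
      = (F y v, \<lambda>u. if u < net y then m2 y u v else [])"
    then have F: "F x v = F y v" and eq: "\<And>u. u < net x \<Longrightarrow> m2 x u v = m2 y u v"
      by (auto simp: fun_eq_iff) (metis+)
    have *: "(\<exists>u<net z. (a, b, v) \<in> set (ms z u)) \<longleftrightarrow> (\<exists>w<net z. (a, b, v) \<in> set (m2 z w v))"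
      if z: "z \<in> X" for z a b
    proof -
      have un: "(\<Union>w<net z. set (m1 z u w)) = set (ms z u)" if "u < net z" for u
        unfolding m1_def using rng[OF z that] bnd[OF z that] by (intro set_spread_UN) auto
      have "(\<exists>u<net z. (a, b, v) \<in> set (ms z u)) \<longleftrightarrow> (\<exists>u<net z. \<exists>w<net z. (a, b, v) \<in> set (m1 z u w))"
        using un by blast
      also have "\<dots> \<longleftrightarrow> (\<exists>w<net z. (a, b, v) \<in> set (m2 z w v))"
        unfolding m2_def by (simp add: Bex_def) blast
      finally show ?thesis .
    qed
    have "(\<exists>u<net x. (a, b, v) \<in> set (ms x u)) \<longleftrightarrow> (\<exists>u<net y. (a, b, v) \<in> set (ms y u))" for a b
      using *[OF xy(1)] *[OF xy(2)] eq n by auto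
    with F show "(F x v, {(a, b). \<exists>u<net x. (a, b, v) \<in> set (ms x u)})
      = (F y v, {(a, b). \<exists>u<net y. (a, b, v) \<in> set (ms y u)})"
      by simp
  qed
  then show ?thesis
    by (rule knows_mono) simp
qed

end

text \<open>The nodes are split into about \<open>\<surd>n\<close> groups, the residue classes modulo \<open>\<lfloor>\<surd>n\<rfloor>\<close>;
  group \<open>g\<close> contains at least the \<open>\<lfloor>\<surd>n\<rfloor>\<close> nodes \<open>g + \<lfloor>\<surd>n\<rfloor> * j\<close> with \<open>j < \<lfloor>\<surd>n\<rfloor>\<close>.\<close>

lemma floor_sqrt_bounds:
  assumes "n > 0"
  shows "floor_sqrt n > 0" "floor_sqrt n * floor_sqrt n \<le> n" "n \<le> floor_sqrt n * (floor_sqrt n + 2)"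
    "(floor_sqrt n + 2) * (floor_sqrt n + 2) \<le> n * 9"
proof -
  let ?q = "floor_sqrt n"
  show q: "?q > 0" using assms by simp
  show sq: "?q * ?q \<le> n" using floor_sqrt_power2_le[of n] by (simp add: power2_eq_square)
  show "n \<le> ?q * (?q + 2)"
    using Suc_floor_sqrt_power2_gt[of n] by (simp add: power2_eq_square algebra_simps)
  have "(?q + 2) * (?q + 2) \<le> (3 * ?q) * (3 * ?q)"
    using q by (intro mult_mono) linarith+
  also have "\<dots> \<le> n * 9" using sq by simp
  finally show "(?q + 2) * (?q + 2) \<le> n * 9" .
qed

text \<open>The position \<open>v div floor_sqrt n\<close> identifies a node within its group, so
  vectors with \<open>floor_sqrt n + 2\<close> entries can hold one number for each member.\<close>

lemma group_position_less:
  assumes "v < n" shows "v div floor_sqrt n < floor_sqrt n + 2"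
  using floor_sqrt_bounds[of n] assms by (intro less_mult_imp_div_less) (simp add: ac_simps)

lemma card_group_le: "card {v. v < n \<and> v mod floor_sqrt n = g} \<le> floor_sqrt n + 2"
proof -
  let ?q = "floor_sqrt n"
  have "inj_on (\<lambda>v. v div ?q) {v. v < n \<and> v mod ?q = g}"
    by (rule inj_onI) (metis (mono_tags, lifting) div_mult_mod_eq mem_Collect_eq)
  moreover have "(\<lambda>v. v div ?q) ` {v. v < n \<and> v mod ?q = g} \<subseteq> {..<?q + 2}"
    using group_position_less by auto
  ultimately have "card {v. v < n \<and> v mod ?q = g} \<le> card {..<?q + 2}"
    by (intro card_inj_on_le) auto
  then show ?thesis by simp
qed

section \<open>Sharing counts within groups\<close>

context clique_inputs
begin

text \<open>Every node sends its q + 2 entries to the at most q + 2 members of its group, hence at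
  most 9 n packets, and receives as many. Unlike in general routing, the traffic pattern
  \<open>c\<close> depends on n alone, so all nodes can compute a balanced colouring of it at once.
  It loads each link with at most 2 * 9 + 1 = 19 packets per hop, and the two hops take 2 + 2 * 19 =
  40 rounds.\<close>

lemma knows_share:
  assumes start: "knows (\<lambda>x u. (F x u, vec x u)) B"
    and vec: "\<And>x u i. x \<in> X \<Longrightarrow> u < net x \<Longrightarrow> i < floor_sqrt (net x) + 2 \<Longrightarrow> vec x u i \<le> net x ^ d"
  shows "knows (\<lambda>x v. (F x v, \<lambda>u i. if u < net x \<and> u mod floor_sqrt (net x) = v mod floor_sqrt (net x)
      \<and> i < floor_sqrt (net x) + 2 then vec x u i else 0)) (\<lambda>x. B x + 40)"
proof -
  define q where "q x = floor_sqrt (net x)" for x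
  define c where "c x u w = (if u mod q x = w mod q x then q x + 2 else 0)" for x u w
  \<comment> \<open>A packet has room for two numbers besides its target, so the index of the entry
    and the sender are paired into one.\<close>
  define ms where "ms x u = concat (map (\<lambda>w. if u mod q x = w mod q x
      then map (\<lambda>i. (vec x u i, prod_encode (i, u), w)) [0..<q x + 2] else []) [0..<net x])" for x u
  define \<phi> where "\<phi> x u = balanced (net x) (c x) u" for x u
  have set_ms: "(a, b, w) \<in> set (ms x u) \<longleftrightarrow> w < net x \<and> u mod q x = w mod q x \<and>
      (\<exists>i<q x + 2. a = vec x u i \<and> b = prod_encode (i, u))" for a b w x u
    by (auto simp: ms_def image_iff simp del: upt_Suc add_2_eq_Suc' split: if_splits)
  have count: "count_class target (ms x u) b = c x u b" if "b < net x" for x u b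
  proof -
    have "count_class target (ms x u) b = (\<Sum>w<net x. if w = b then c x u b else 0)"
      unfolding ms_def count_class_concat
      by (intro sum.cong refl) (auto simp: count_class_def c_def o_def filter_empty_conv)
    then show ?thesis using that by simp
  qed
  have sum_c: "(\<Sum>w<net x. c x u w) \<le> net x * 9" if "x \<in> X" for x u
  proof -
    have "(\<Sum>w<net x. c x u w) = (\<Sum>w | w < net x \<and> w mod q x = u mod q x. q x + 2)"
      by (rule sum.mono_neutral_cong_right) (auto simp: c_def)
    also have "\<dots> \<le> (q x + 2) * (q x + 2)"
      using card_group_le[of "net x" "u mod q x"] by (simp add: q_def del: add_2_eq_Suc add_2_eq_Suc')
    also have "\<dots> \<le> net x * 9"
      using floor_sqrt_bounds(4)[of "net x"] net_ge_2[OF that] by (simp add: q_def)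
    finally show ?thesis .
  qed
  have c_sym: "c x u w = c x w u" for x u w
    by (auto simp: c_def)
  \<comment> \<open>The index and the sender are at most n^2, so their code is at most (n^2)^6. The
    exponent also gives 19 \<le> 2^5 \<le> n^d'.\<close>
  define d' where "d' = max d 12"
  have pow: "k \<le> net x ^ d'" if "k \<le> net x ^ e" "e \<le> d'" "x \<in> X" for k e x
    using that power_increasing[of e d' "net x"] net_ge_2[of x] by (meson le_trans one_le_numeral)
  have "knows (\<lambda>x u. (F x u, ms x u, \<phi> x u)) B"
  proof (rule knows_determined[OF start])
    fix x y u
    assume n: "net y = net x" and eq: "(F x u, vec x u) = (F y u, vec y u)"
    then have "q y = q x" by (simp add: q_def)
    then have "c y = c x" by (simp add: c_def fun_eq_iff)
    then show "(F x u, ms x u, \<phi> x u) = (F y u, ms y u, \<phi> y u)"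
      using n eq \<open>q y = q x\<close> by (simp add: ms_def \<phi>_def cong: if_cong)
  qed
  then have "knows (\<lambda>x v. (F x v, {(a, b). \<exists>u<net x. (a, b, v) \<in> set (ms x u)})) (\<lambda>x. B x + 2 + 2 * 19)"
  proof (rule knows_two_hop[where d = d'])
    fix x assume x: "x \<in> X"
    have n: "net x > 0" using net_ge_2[OF x] by simp
    show "\<phi> x u b i < net x" for u b i
      using balanced_less[OF n] by (simp add: \<phi>_def)
    show "packet_bounded (net x ^ d') t \<and> target t < net x"
      if u: "u < net x" and t: "t \<in> set (ms x u)" for u t
    proof -
      obtain a b w where abw: "t = (a, b, w)" by (rule prod_cases3)
      then obtain i where t: "t = (vec x u i, prod_encode (i, u), w)" "w < net x" "i < q x + 2"
        using t set_ms by auto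
      have "q x * 1 \<le> q x * q x" 
        using floor_sqrt_bounds(1)[OF n] unfolding q_def by (intro mult_le_mono2) linarith
      then have "i \<le> net x + 1"
        using t(3) floor_sqrt_bounds(2)[OF n] unfolding q_def by linarith
      also have "\<dots> \<le> net x * net x"
        using mult_le_mono1[OF net_ge_2[OF x], of "net x"] net_ge_2[OF x] by linarith
      finally have "i \<le> (net x)\<^sup>2" by (simp add: power2_eq_square)
      moreover have "u \<le> (net x)\<^sup>2" "(2::nat) \<le> (net x)\<^sup>2"
        using u net_ge_2[OF x] by (auto simp: power2_eq_square intro: order.trans[OF _ le_square])
      ultimately have "prod_encode (i, u) \<le> ((net x)\<^sup>2) ^ 6"
        by (intro prod_encode_le)
      then have "prod_encode (i, u) \<le> net x ^ 12"
        by (simp flip: power_mult)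
      then show ?thesis
        using t vec[OF x u, of i] pow[of _ x d] pow[of _ x 12] pow[of w x 1] x
        by (auto simp: packet_bounded_def q_def d'_def)
    qed
    show "(\<Sum>b<net x. card {i. i < count_class target (ms x u) b \<and> \<phi> x u b i = y}) \<le> 19"
      if "u < net x" for u y
      using le_of_scaled[OF balanced_source[OF n that, of "c x" y] sum_c[OF x] n]
      by (simp add: count \<phi>_def)
    show "(\<Sum>u<net x. card {i. i < count_class target (ms x u) v \<and> \<phi> x u v i = y}) \<le> 19"
      if "v < net x" for v y
      using le_of_scaled[OF balanced_target[OF n that, of "c x" y] _ n, of 9] sum_c[OF x, of v]
      by (simp add: count that \<phi>_def c_sym[of x _ v])
    show "19 \<le> net x ^ d'"
      using power_mono[of 2 "net x" 5] net_ge_2[OF x] by (intro pow[of _ x 5]) (auto simp: x d'_def)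
  qed
  then have "knows (\<lambda>x v. (F x v, {(a, b). \<exists>u<net x. (a, b, v) \<in> set (ms x u)})) (\<lambda>x. B x + 40)"
    by (simp add: numeral_eq_Suc)
  then show ?thesis
    unfolding q_def[symmetric]
  proof (rule knows_determined)
    fix x y v
    assume n: "net y = net x" and v: "v < net x"
      and eq: "(F x v, {(a, b). \<exists>u<net x. (a, b, v) \<in> set (ms x u)})
        = (F y v, {(a, b). \<exists>u<net y. (a, b, v) \<in> set (ms y u)})"
    have q: "q y = q x" by (simp add: q_def n)
    have "vec x u i = vec y u i" if u: "u < net x" "u mod q x = v mod q x" "i < q x + 2" for u i
    proof -
      have "(vec x u i, prod_encode (i, u)) \<in> {(a, b). \<exists>u<net x. (a, b, v) \<in> set (ms x u)}"
        using u v by (auto simp: set_ms)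
      then have "(vec x u i, prod_encode (i, u)) \<in> {(a, b). \<exists>u<net y. (a, b, v) \<in> set (ms y u)}"
        using eq by (simp only: prod.inject)
      then show ?thesis by (auto simp: set_ms prod_encode_eq)
    qed
    with eq n q show "(F x v, \<lambda>u i. if u < net x \<and> u mod q x = v mod q x \<and> i < q x + 2 then vec x u i else 0)
      = (F y v, \<lambda>u i. if u < net y \<and> u mod q y = v mod q y \<and> i < q y + 2 then vec y u i else 0)"
      by (simp add: fun_eq_iff)
  qed
qed

end

lemma mset_concat_upt: "mset (concat (map f [0..<n])) = (\<Sum>u<n. mset (f u))"
  by (simp add: mset_concat o_def sum_list_upt)

lemma sum_count_class_cong:
  fixes n :: nat
  assumes "(\<Sum>u<n. mset (f u)) = (\<Sum>u<n. mset (g u))"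
  shows "(\<Sum>u<n. count_class cls (f u) b) = (\<Sum>u<n. count_class cls (g u) b)"
proof -
  have *: "(\<Sum>u<n. count_class cls (f u) b) = size (filter_mset (\<lambda>t. cls t = b) (\<Sum>u<n. mset (f u)))" for f
  proof -
    have "(\<Sum>u<n. count_class cls (f u) b) = count_class cls (concat (map f [0..<n])) b"
      by (rule count_class_concat[symmetric])
    also have "\<dots> = size (filter_mset (\<lambda>t. cls t = b) (mset (concat (map f [0..<n]))))"
      by (simp only: count_class_def mset_filter[symmetric] size_mset)
    finally show ?thesis by (simp only: mset_concat_upt)
  qed
  show ?thesis unfolding *[of f] *[of g] assms ..
qed

lemma card_residue_le:
  assumes "(q::nat) > 0"
  shows "card {i. i < N \<and> i mod q = j} \<le> N div q + 1"
proof -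
  have "inj_on (\<lambda>i. i div q) {i. i < N \<and> i mod q = j}"
    by (rule inj_onI) (metis (mono_tags, lifting) div_mult_mod_eq mem_Collect_eq)
  moreover have "(\<lambda>i. i div q) ` {i. i < N \<and> i mod q = j} \<subseteq> {..N div q}"
    by (auto simp: div_le_mono)
  ultimately have "card {i. i < N \<and> i mod q = j} \<le> card {..N div q}"
    by (intro card_inj_on_le) auto
  then show ?thesis by simp
qed

context clique_inputs
begin

text \<open>Deterministic routing in the spirit of Lenzen. First, the messages from one group to another
  are spread evenly over all nodes, who then pass them on in a round robin fashion to the target
  group. In both cases balancing within a group only needs the \<open>O(n)\<close> numbers that its members
  share. Finally, messages are delivered within the groups.\<close>

lemma knows_routing:
  assumes start: "knows (\<lambda>x u. (F x u, ms x u)) B"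
    and bnd: "\<And>x u t. x \<in> X \<Longrightarrow> u < net x \<Longrightarrow> t \<in> set (ms x u) \<Longrightarrow>
      packet_bounded (net x ^ d) t \<and> target t < net x"
    and out: "\<And>x u. x \<in> X \<Longrightarrow> u < net x \<Longrightarrow> length (ms x u) \<le> net x * K x"
    and into: "\<And>x v. x \<in> X \<Longrightarrow> v < net x \<Longrightarrow>
      (\<Sum>u<net x. count_class target (ms x u) v) \<le> net x * K x"
    and K: "\<And>x. x \<in> X \<Longrightarrow> K x \<le> net x ^ d"
  shows "knows (\<lambda>x v. (F x v, {(a, b). \<exists>u<net x. (a, b, v) \<in> set (ms x u)}))
    (\<lambda>x. B x + 100 + 32 * K x)"
proof -
  define q where "q x = floor_sqrt (net x)" for x
  \<comment> \<open>Until the final delivery only the group of the target matters.\<close>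
  define cls where "cls x t = target t mod q x" for x and t :: packet
  define cg where "cg x u g = count_class (cls x) (ms x u) g" for x u g
  \<comment> \<open>One matrix per source group, zero outside it: it is made up entirely of numbers
    that the members of group \<open>\<gamma>\<close> share, and each group computes its colouring
    on its own.\<close>
  define c where "c x \<gamma> u g = (if u < net x \<and> u mod q x = \<gamma> \<and> g < q x + 2 then cg x u g else 0)"
    for x \<gamma> u g
  define \<phi> where "\<phi> x u = balanced (net x) (c x (u mod q x)) u" for x u
  define m1 where "m1 x u = spread (q x) (cls x) (ms x u) (\<phi> x u)" for x u
  define ms1 where "ms1 x y = concat (map (\<lambda>u. m1 x u y) [0..<net x])" for x y
  \<comment> \<open>The \<open>i\<close>-th message for group \<open>b\<close> goes to the member of
    that group in position i mod q. Only the q positions that exist in every group are used, and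
    reducing \<open>b\<close> keeps the value below n for every \<open>b\<close>.\<close>
  define \<rho> where "\<rho> x b i = b mod q x + q x * (i mod q x)" for x b i
  define m2 where "m2 x y = spread (q x) (cls x) (ms1 x y) (\<rho> x)" for x y
  define ms2 where "ms2 x z = concat (map (\<lambda>y. m2 x y z) [0..<net x])" for x z
  \<comment> \<open>Counts are indexed by the position of the target in the group, so that they form
    a vector for \<open>knows_share\<close>.\<close>
  define cg' where "cg' x z i = count_class target (ms2 x z) (z mod q x + q x * i)" for x z i
  define c' where "c' x \<gamma> z v = (if z < net x \<and> z mod q x = \<gamma> \<and> v mod q x = \<gamma> \<and> v < net x
    then count_class target (ms2 x z) v else 0)" for x \<gamma> z v
  define \<phi>' where "\<phi>' x z = balanced (net x) (c' x (z mod q x)) z" for x z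
  have n: "net x > 0" if "x \<in> X" for x using net_ge_2[OF that] by simp
  have q: "q x > 0" if "x \<in> X" for x
    using floor_sqrt_bounds(1)[OF n[OF that]] by (simp add: q_def)
  have q2: "q x * q x \<le> net x" for x
    by (cases "net x = 0") (use floor_sqrt_bounds(2) in \<open>auto simp: q_def\<close>)
  have q_le: "q x \<le> net x" for x
    using q2[of x] le_square[of "q x"] by linarith
  have cls_less: "cls x t < q x" if "x \<in> X" for x t
    using q[OF that] by (simp add: cls_def)
  have q_net: "q y = q x" if "net y = net x" for x y
    using that by (simp add: q_def)
  \<comment> \<open>All loads below, such as 12 K + 5, are at most 32 n^d \<le> n^(d+5).\<close>
  define e where "e = d + 5"
  have e2: "net x ^ d * 32 \<le> net x ^ e" if "x \<in> X" for x
  proof -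
    have "(2::nat) ^ 5 \<le> net x ^ 5" using net_ge_2[OF that] by (intro power_mono) auto
    then show ?thesis by (simp add: e_def power_add)
  qed
  have pow: "k \<le> net x ^ e" if "k \<le> net x ^ d * 32" "x \<in> X" for k x
    using that e2 by fastforce
  have bnd_e: "packet_bounded (net x ^ e) t" if "x \<in> X" "u < net x" "t \<in> set (ms x u)" for x u t
    using bnd[OF that] e2[OF that(1)] by (auto intro: packet_bounded_mono)
  have "knows (\<lambda>x u. ((F x u, ms x u), cg x u)) B"
    by (rule knows_determined[OF start]) (simp add: cg_def[abs_def] cls_def[abs_def] q_def)
  then have "knows (\<lambda>x v. ((F x v, ms x v), \<lambda>u i. if u < net x \<and>
      u mod floor_sqrt (net x) = v mod floor_sqrt (net x) \<and> i < floor_sqrt (net x) + 2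
      then cg x u i else 0)) (\<lambda>x. B x + 40)"
  proof (rule knows_share[where d = "Suc d"])
    fix x u i assume *: "x \<in> X" "u < net x"
    have "cg x u i \<le> net x * K x"
      using out[OF *] count_class_le_length unfolding cg_def by (rule order.trans[rotated])
    also have "\<dots> \<le> net x * net x ^ d"
      using K[OF *(1)] by simp
    finally show "cg x u i \<le> net x ^ Suc d" by simp
  qed
  then have "knows (\<lambda>x v. ((F x v, ms x v), c x (v mod q x))) (\<lambda>x. B x + 40)"
    by (simp add: c_def[abs_def] q_def[abs_def])
  then have "knows (\<lambda>x u. (F x u, m1 x u)) (\<lambda>x. B x + 40)"
    by (rule knows_determined) (simp add: m1_def cls_def[abs_def] \<phi>_def q_def)
  then have "knows (\<lambda>x y. (F x y, \<lambda>u. if u < net x then m1 x u y else [])) (\<lambda>x. (B x + 40) + 1 + (2 * K x + 1))"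
  proof (rule knows_stage[where d = e])
    fix x u y assume x: "x \<in> X" and u: "u < net x"
    have "length (m1 x u y)
        = (\<Sum>g<q x. card {i. i < c x (u mod q x) u g \<and> balanced (net x) (c x (u mod q x)) u g i = y})"
      unfolding m1_def length_spread \<phi>_def using u by (intro sum.cong) (auto simp: c_def cg_def)
    also have "\<dots> \<le> (\<Sum>g<net x. card {i. i < c x (u mod q x) u g \<and> balanced (net x) (c x (u mod q x)) u g i = y})"
      using q_le[of x] by (intro sum_mono2) auto
    also have "\<dots> \<le> 2 * K x + 1"
    proof (rule le_of_scaled[OF balanced_source[OF n[OF x] u] _ n[OF x]])
      have "(\<Sum>g<net x. c x (u mod q x) u g) \<le> (\<Sum>g<net x. cg x u g)"
        by (intro sum_mono) (simp add: c_def)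
      also have "\<dots> = length (filter (\<lambda>t. cls x t < net x) (ms x u))"
        unfolding cg_def by (rule sum_count_class) auto
      also have "\<dots> \<le> net x * K x"
        using out[OF x u] length_filter_le order.trans by blast
      finally show "(\<Sum>g<net x. c x (u mod q x) u g) \<le> net x * K x" .
    qed
    finally show "length (m1 x u y) \<le> 2 * K x + 1" .
    show "packet_bounded (net x ^ e) t" if "t \<in> set (m1 x u y)" for t
      using that unfolding m1_def by (intro bnd_e[OF x u]) (rule subsetD[OF set_spread])
  next
    fix x assume x: "x \<in> X"
    have "1 \<le> net x ^ d" using n[OF x] by simp
    then show "2 * K x + 1 \<le> net x ^ e" using K[OF x] by (intro pow x) linarith
  qed
  then have "knows (\<lambda>x y. (F x y, ms1 x y)) (\<lambda>x. (B x + 40) + 1 + (2 * K x + 1))"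
  proof (rule knows_determined)
    fix x y v
    assume n: "net y = net x" and "(F x v, \<lambda>u. if u < net x then m1 x u v else [])
      = (F y v, \<lambda>u. if u < net y then m1 y u v else [])"
    then have "F x v = F y v" and "\<And>u. u < net x \<Longrightarrow> m1 x u v = m1 y u v"
      by (auto simp: fun_eq_iff) (metis+)
    then show "(F x v, ms1 x v) = (F y v, ms1 y v)"
      using n by (auto simp: ms1_def intro!: arg_cong[where f = concat])
  qed
  then have knows1: "knows (\<lambda>x y. (F x y, m2 x y)) (\<lambda>x. (B x + 40) + 1 + (2 * K x + 1))"
    by (rule knows_determined) (simp add: m2_def cls_def[abs_def] \<rho>_def[abs_def] q_def)
  have \<phi>_less: "\<phi> x u b i < net x" if "x \<in> X" for x u b i
    using balanced_less[OF n[OF that]] by (simp add: \<phi>_def)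
  have ms1_mset: "(\<Sum>y<net x. mset (ms1 x y)) = (\<Sum>u<net x. mset (ms x u))" if x: "x \<in> X" for x
    unfolding ms1_def mset_concat_upt
    by (subst sum.swap) (use cls_less[OF x] \<phi>_less[OF x] in \<open>simp add: m1_def mset_spread\<close>)
  \<comment> \<open>A target group has at most q + 2 members, each of which receives at most n K
    messages.\<close>
  have group_total: "(\<Sum>u<net x. cg x u g) \<le> net x * (K x * (q x + 2))" if x: "x \<in> X" for x g
  proof -
    let ?G = "{v. v < net x \<and> v mod q x = g}"
    have "cg x u g = (\<Sum>v\<in>?G. count_class target (ms x u) v)" if "u < net x" for u
    proof -
      have "(\<Sum>v\<in>?G. count_class target (ms x u) v) = length (filter (\<lambda>t. cls x t = g) (ms x u))"
        by (rule sum_count_class) (use bnd[OF x that] in \<open>auto simp: cls_def\<close>)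
      then show ?thesis by (simp add: cg_def count_class_def)
    qed
    then have "(\<Sum>u<net x. cg x u g) = (\<Sum>v\<in>?G. \<Sum>u<net x. count_class target (ms x u) v)"
      by (subst sum.swap) simp
    also have "\<dots> \<le> (\<Sum>v\<in>?G. net x * K x)"
      using into[OF x] by (intro sum_mono) auto
    also have "\<dots> \<le> (q x + 2) * (net x * K x)"
      using card_group_le[of "net x" g] unfolding q_def sum_constant of_nat_id by (rule mult_le_mono1)
    finally show ?thesis by (simp only: ac_simps)
  qed
  \<comment> \<open>The q source groups are coloured independently and each may exceed twice its
    average by one, which gives the final summand q.\<close>
  have ms1_count: "count_class (cls x) (ms1 x y) g \<le> 2 * (K x * (q x + 2)) + q x"
    if x: "x \<in> X" and g: "g < q x" for x y g
  proof -
    define l where "l \<gamma> u = card {i. i < c x \<gamma> u g \<and> balanced (net x) (c x \<gamma>) u g i = y}" for \<gamma> u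
    have "count_class (cls x) (ms1 x y) g = (\<Sum>u<net x. l (u mod q x) u)"
      unfolding ms1_def count_class_concat m1_def l_def
      by (intro sum.cong refl) (use g in \<open>auto simp: count_class_spread c_def cg_def \<phi>_def\<close>)
    also have "\<dots> = (\<Sum>\<gamma><q x. \<Sum>u | u \<in> {..<net x} \<and> u mod q x = \<gamma>. l (u mod q x) u)"
      by (rule sum.group[symmetric]) (use q[OF x] in auto)
    also have "\<dots> \<le> (\<Sum>\<gamma><q x. \<Sum>u<net x. l \<gamma> u)"
    proof (rule sum_mono)
      fix \<gamma>
      have "(\<Sum>u | u \<in> {..<net x} \<and> u mod q x = \<gamma>. l (u mod q x) u)
          = (\<Sum>u | u \<in> {..<net x} \<and> u mod q x = \<gamma>. l \<gamma> u)"
        by (intro sum.cong) auto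
      also have "\<dots> \<le> (\<Sum>u<net x. l \<gamma> u)"
        by (intro sum_mono2) auto
      finally show "(\<Sum>u | u \<in> {..<net x} \<and> u mod q x = \<gamma>. l (u mod q x) u) \<le> (\<Sum>u<net x. l \<gamma> u)" .
    qed
    finally have "net x * count_class (cls x) (ms1 x y) g \<le> (\<Sum>\<gamma><q x. net x * (\<Sum>u<net x. l \<gamma> u))"
      by (simp flip: sum_distrib_left)
    also have "\<dots> \<le> (\<Sum>\<gamma><q x. 2 * (\<Sum>u<net x. c x \<gamma> u g) + net x)"
      unfolding l_def using balanced_target[OF n[OF x]] g q_le[of x] by (intro sum_mono) simp
    also have "\<dots> = 2 * (\<Sum>u<net x. \<Sum>\<gamma><q x. c x \<gamma> u g) + q x * net x"
    proof -
      have swap: "(\<Sum>u<net x. \<Sum>\<gamma><q x. c x \<gamma> u g) = (\<Sum>\<gamma><q x. \<Sum>u<net x. c x \<gamma> u g)"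
        by (rule sum.swap)
      show ?thesis
        unfolding swap by (simp add: sum.distrib sum_distrib_left)
    qed
    also have "(\<Sum>u<net x. \<Sum>\<gamma><q x. c x \<gamma> u g) \<le> (\<Sum>u<net x. cg x u g)"
    proof (rule sum_mono)
      fix u
      have "(\<Sum>\<gamma><q x. c x \<gamma> u g) \<le> (\<Sum>\<gamma><q x. if u mod q x = \<gamma> then cg x u g else 0)"
        by (intro sum_mono) (auto simp: c_def)
      then show "(\<Sum>\<gamma><q x. c x \<gamma> u g) \<le> cg x u g"
        using q[OF x] by simp
    qed
    also have "\<dots> \<le> net x * (K x * (q x + 2))"
      by (rule group_total[OF x])
    finally have "net x * count_class (cls x) (ms1 x y) g \<le> net x * (2 * (K x * (q x + 2)) + q x)"
      by (simp add: algebra_simps)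
    then show ?thesis using n[OF x] by (metis nat_mult_le_cancel1)
  qed
  \<comment> \<open>At most 2 K (q + 2) + q \<le> (6 K + 1) q messages for one group are dealt to q
    members in turn, and an incomplete last turn costs one more.\<close>
  have m2_len: "length (m2 x y z) \<le> 6 * K x + 2" if x: "x \<in> X" for x y z
  proof -
    let ?N = "count_class (cls x) (ms1 x y) (z mod q x)"
    have "length (m2 x y z)
        = (\<Sum>b<q x. card {i. i < count_class (cls x) (ms1 x y) b \<and> \<rho> x b i = z})"
      by (simp add: m2_def length_spread)
    also have "\<dots> \<le> (\<Sum>b<q x. if b = z mod q x then card {i. i < ?N \<and> i mod q x = z div q x} else 0)"
    proof (intro sum_mono)
      fix b assume b: "b \<in> {..<q x}"
      have *: "b = z mod q x \<and> i mod q x = z div q x" if "\<rho> x b i = z" for i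
        using that b q[OF x] by (auto simp: \<rho>_def)
      show "card {i. i < count_class (cls x) (ms1 x y) b \<and> \<rho> x b i = z}
          \<le> (if b = z mod q x then card {i. i < ?N \<and> i mod q x = z div q x} else 0)"
      proof (cases "b = z mod q x")
        case True
        then show ?thesis using * by (auto intro!: card_mono)
      next
        case False
        then have "{i. i < count_class (cls x) (ms1 x y) b \<and> \<rho> x b i = z} = {}"
          using * by blast
        with False show ?thesis by simp
      qed
    qed
    also have "\<dots> \<le> ?N div q x + 1"
      using q[OF x] card_residue_le[OF q[OF x]] by simp
    also have "?N \<le> (6 * K x + 1) * q x"
    proof -
      have "?N \<le> 2 * (K x * (q x + 2)) + q x"
        using ms1_count[OF x, of "z mod q x" y] q[OF x] by simp
      also have "\<dots> \<le> 2 * (K x * (q x * 3)) + q x"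
        using q[OF x] by (intro add_right_mono mult_le_mono2) linarith
      finally show ?thesis by (simp add: algebra_simps)
    qed
    finally show ?thesis
      using q[OF x] by (simp add: div_le_mono)
  qed
  have ms1_sub: "set (ms1 x y) \<subseteq> (\<Union>u<net x. set (ms x u))" for x y
  proof
    fix t assume "t \<in> set (ms1 x y)"
    then obtain u where u: "u < net x" "t \<in> set (m1 x u y)"
      unfolding ms1_def by auto
    from u(2) have "t \<in> set (ms x u)"
      unfolding m1_def by (rule subsetD[OF set_spread])
    with u(1) show "t \<in> (\<Union>u<net x. set (ms x u))" by auto
  qed
  have m2_sub: "set (m2 x y z) \<subseteq> (\<Union>u<net x. set (ms x u))" for x y z
    unfolding m2_def by (rule order.trans[OF set_spread ms1_sub])
  have "knows (\<lambda>x z. (F x z, \<lambda>y. if y < net x then m2 x y z else []))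
      (\<lambda>x. ((B x + 40) + 1 + (2 * K x + 1)) + 1 + (6 * K x + 2))"
  proof (rule knows_stage[OF knows1, where d = e])
    show "length (m2 x u v) \<le> 6 * K x + 2" if "x \<in> X" for x u v
      by (rule m2_len[OF that])
    show "packet_bounded (net x ^ e) t" if x: "x \<in> X" and t: "t \<in> set (m2 x u v)" for x u v t
    proof -
      obtain w where "w < net x" "t \<in> set (ms x w)"
        using subsetD[OF m2_sub t] by blast
      then show ?thesis by (rule bnd_e[OF x])
    qed
  next
    fix x assume x: "x \<in> X"
    have "1 \<le> net x ^ d" using n[OF x] by simp
    then show "6 * K x + 2 \<le> net x ^ e" using K[OF x] by (intro pow x) linarith
  qed
  then have knows2: "knows (\<lambda>x z. (F x z, ms2 x z)) (\<lambda>x. ((B x + 40) + 1 + (2 * K x + 1)) + 1 + (6 * K x + 2))"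
  proof (rule knows_determined)
    fix x y v
    assume n: "net y = net x" and "(F x v, \<lambda>u. if u < net x then m2 x u v else [])
      = (F y v, \<lambda>u. if u < net y then m2 y u v else [])"
    then have "F x v = F y v" and "\<And>u. u < net x \<Longrightarrow> m2 x u v = m2 y u v"
      by (auto simp: fun_eq_iff) (metis+)
    then show "(F x v, ms2 x v) = (F y v, ms2 y v)"
      using n by (auto simp: ms2_def intro!: arg_cong[where f = concat])
  qed
  have \<rho>_less: "\<rho> x b i < net x" if x: "x \<in> X" for x b i
  proof -
    have "\<rho> x b i < q x + q x * (i mod q x)"
      using q[OF x] by (simp add: \<rho>_def)
    also have "\<dots> = q x * Suc (i mod q x)" by simp
    also have "\<dots> \<le> q x * q x"
      using mod_less_divisor[OF q[OF x], of i] by (intro mult_le_mono2) linarith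
    also note q2
    finally show ?thesis .
  qed
  have ms2_mset: "(\<Sum>z<net x. mset (ms2 x z)) = (\<Sum>u<net x. mset (ms x u))" if x: "x \<in> X" for x
    unfolding ms2_def mset_concat_upt ms1_mset[OF x, symmetric]
    by (subst sum.swap) (use cls_less[OF x] \<rho>_less[OF x] in \<open>simp add: m2_def mset_spread\<close>)
  have ms2_sub: "set (ms2 x z) \<subseteq> (\<Union>u<net x. set (ms x u))" for x z
  proof
    fix t assume "t \<in> set (ms2 x z)"
    then obtain y where "t \<in> set (m2 x y z)"
      unfolding ms2_def by auto
    then show "t \<in> (\<Union>u<net x. set (ms x u))"
      by (rule subsetD[OF m2_sub])
  qed
  have ms2_len: "length (ms2 x z) \<le> net x * (6 * K x + 2)" if x: "x \<in> X" for x z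
  proof -
    have "length (ms2 x z) = (\<Sum>y<net x. length (m2 x y z))"
      by (simp add: ms2_def length_concat o_def sum_list_upt)
    also have "\<dots> \<le> (\<Sum>y<net x. 6 * K x + 2)"
      using m2_len[OF x] by (intro sum_mono)
    finally show ?thesis by simp
  qed
  have ms2_cls: "target t mod q x = z mod q x" if x: "x \<in> X" and t: "t \<in> set (ms2 x z)" for x z t
  proof (rule ccontr)
    assume neq: "target t mod q x \<noteq> z mod q x"
    obtain y where "t \<in> set (m2 x y z)"
      using t by (auto simp: ms2_def)
    then have "count_class (cls x) (m2 x y z) (cls x t) \<noteq> 0"
      by (auto simp: count_class_def filter_empty_conv)
    moreover have "\<rho> x (cls x t) i \<noteq> z" for i
    proof
      assume "\<rho> x (cls x t) i = z"
      then have "z mod q x = cls x t" by (auto simp: \<rho>_def cls_def)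
      with neq show False by (simp add: cls_def)
    qed
    ultimately show False
      by (simp add: m2_def count_class_spread[OF cls_less[OF x]])
  qed
  have c'_eq: "count_class target (ms2 x z) b = c' x (z mod q x) z b"
    if "x \<in> X" "z < net x" "b < net x" for x z b
    using that ms2_cls[OF that(1), of _ z] by (auto simp: c'_def count_class_def filter_empty_conv)
  have "knows (\<lambda>x z. ((F x z, ms2 x z), cg' x z)) (\<lambda>x. ((B x + 40) + 1 + (2 * K x + 1)) + 1 + (6 * K x + 2))"
    by (rule knows_determined[OF knows2]) (simp add: cg'_def[abs_def] q_def)
  then have "knows (\<lambda>x v. ((F x v, ms2 x v), \<lambda>u i. if u < net x \<and>
      u mod floor_sqrt (net x) = v mod floor_sqrt (net x) \<and> i < floor_sqrt (net x) + 2
      then cg' x u i else 0)) (\<lambda>x. (((B x + 40) + 1 + (2 * K x + 1)) + 1 + (6 * K x + 2)) + 40)"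
  proof (rule knows_share[where d = "Suc e"])
    fix x u i assume *: "x \<in> X" "u < net x"
    have "cg' x u i \<le> net x * (6 * K x + 2)"
      using ms2_len[OF *(1)] count_class_le_length unfolding cg'_def by (rule order.trans[rotated])
    also have "\<dots> \<le> net x * net x ^ e"
    proof (intro mult_le_mono2 pow *(1))
      have "1 \<le> net x ^ d" using n[OF *(1)] by simp
      then show "6 * K x + 2 \<le> net x ^ d * 32" using K[OF *(1)] by linarith
    qed
    finally show "cg' x u i \<le> net x ^ Suc e" by simp
  qed
  then have "knows (\<lambda>x z. (F x z, ms2 x z, \<phi>' x z)) (\<lambda>x. (((B x + 40) + 1 + (2 * K x + 1)) + 1 + (6 * K x + 2)) + 40)"
    unfolding q_def[symmetric]
  proof (rule knows_determined)
    fix x y w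
    define shared where
      "shared x u i = (if u < net x \<and> u mod q x = w mod q x \<and> i < q x + 2 then cg' x u i else 0)" for x u i
    assume n: "net y = net x" and eq: "((F x w, ms2 x w), \<lambda>u i. if u < net x \<and> u mod q x = w mod q x
        \<and> i < q x + 2 then cg' x u i else 0) = ((F y w, ms2 y w), \<lambda>u i. if u < net y \<and>
        u mod q y = w mod q y \<and> i < q y + 2 then cg' y u i else 0)"
    \<comment> \<open>Within a group, \<open>v\<close> is recovered from its position, so the shared
      vectors determine the whole matrix of the group.\<close>
    have c': "c' x (w mod q x) z v = (if v mod q x = w mod q x \<and> v < net x then shared x z (v div q x) else 0)"
      for x z v
    proof -
      have "w mod q x + q x * (v div q x) = v" if "v mod q x = w mod q x"
        using that mod_mult_div_eq[of v "q x"] by simp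
      then show ?thesis
        using group_position_less[of v "net x"] by (auto simp: c'_def shared_def cg'_def q_def[symmetric])
    qed
    have "shared x = shared y"
      using eq unfolding shared_def by simp
    then have "c' x (w mod q x) = c' y (w mod q y)"
      unfolding c' fun_eq_iff using n q_net[OF n] by simp
    then show "(F x w, ms2 x w, \<phi>' x w) = (F y w, ms2 y w, \<phi>' y w)"
      using eq n by (simp add: \<phi>'_def)
  qed
  then have "knows (\<lambda>x v. (F x v, {(a, b). \<exists>u<net x. (a, b, v) \<in> set (ms2 x u)}))
      (\<lambda>x. ((((B x + 40) + 1 + (2 * K x + 1)) + 1 + (6 * K x + 2)) + 40) + 2 + 2 * (12 * K x + 5))"
  proof (rule knows_two_hop[where d = e])
    fix x assume x: "x \<in> X"
    show "\<phi>' x u b i < net x" for u b i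
      using balanced_less[OF n[OF x]] by (simp add: \<phi>'_def)
    show "packet_bounded (net x ^ e) t \<and> target t < net x" if t: "t \<in> set (ms2 x u)" for u t
    proof -
      obtain w where "w < net x" "t \<in> set (ms x w)"
        using subsetD[OF ms2_sub t] by blast
      then show ?thesis using bnd_e[OF x] bnd[OF x] by simp
    qed
    show "12 * K x + 5 \<le> net x ^ e"
    proof -
      have "1 \<le> net x ^ d" using n[OF x] by simp
      then show ?thesis using K[OF x] by (intro pow x) linarith
    qed
    show "(\<Sum>b<net x. card {i. i < count_class target (ms2 x u) b \<and> \<phi>' x u b i = y}) \<le> 12 * K x + 5"
      if u: "u < net x" for u y
    proof -
      have "(\<Sum>b<net x. c' x (u mod q x) u b) = (\<Sum>b<net x. count_class target (ms2 x u) b)"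
        by (intro sum.cong) (use c'_eq[OF x u] in auto)
      also have "\<dots> = length (filter (\<lambda>t. target t < net x) (ms2 x u))"
        by (rule sum_count_class) auto
      also have "\<dots> \<le> net x * (6 * K x + 2)"
        using ms2_len[OF x] length_filter_le order.trans by blast
      finally have "(\<Sum>b<net x. card {i. i < c' x (u mod q x) u b \<and>
          balanced (net x) (c' x (u mod q x)) u b i = y}) \<le> 2 * (6 * K x + 2) + 1"
        by (rule le_of_scaled[OF balanced_source[OF n[OF x] u] _ n[OF x]])
      then show ?thesis
        using c'_eq[OF x u] by (simp add: \<phi>'_def)
    qed
    \<comment> \<open>Only members of the group of \<open>v\<close> still hold messages for
      \<open>v\<close>, so the colouring of this one group accounts for all of them. Their number is
      the original one, because moving messages preserves the joint multiset.\<close>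
    show "(\<Sum>u<net x. card {i. i < count_class target (ms2 x u) v \<and> \<phi>' x u v i = y}) \<le> 12 * K x + 5"
      if v: "v < net x" for v y
    proof -
      let ?c = "c' x (v mod q x)"
      have "(\<Sum>u<net x. ?c u v) \<le> (\<Sum>u<net x. count_class target (ms2 x u) v)"
        by (intro sum_mono) (auto simp: c'_def)
      also have "\<dots> = (\<Sum>u<net x. count_class target (ms x u) v)"
        by (rule sum_count_class_cong[OF ms2_mset[OF x]])
      also have "\<dots> \<le> net x * K x"
        by (rule into[OF x v])
      finally have "(\<Sum>u<net x. card {i. i < ?c u v \<and> balanced (net x) ?c u v i = y}) \<le> 2 * K x + 1"
        by (rule le_of_scaled[OF balanced_target[OF n[OF x] v] _ n[OF x]])
      moreover have "(\<Sum>u<net x. card {i. i < count_class target (ms2 x u) v \<and> \<phi>' x u v i = y})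
          \<le> (\<Sum>u<net x. card {i. i < ?c u v \<and> balanced (net x) ?c u v i = y})"
      proof (rule sum_mono)
        fix u assume "u \<in> {..<net x}"
        then have "count_class target (ms2 x u) v = c' x (u mod q x) u v"
          using c'_eq[OF x _ v] by simp
        then show "card {i. i < count_class target (ms2 x u) v \<and> \<phi>' x u v i = y}
            \<le> card {i. i < ?c u v \<and> balanced (net x) ?c u v i = y}"
          by (cases "u mod q x = v mod q x") (auto simp: \<phi>'_def c'_def)
      qed
      ultimately show ?thesis by linarith
    qed
  qed
  \<comment> \<open>The stages add up to B + 97 + 32 K: a constant 45 with 8 K for the two
    distributions, 40 for sharing, and 12 + 24 K for the two hops.\<close>
  then have "knows (\<lambda>x v. (F x v, {(a, b). \<exists>u<net x. (a, b, v) \<in> set (ms2 x u)})) (\<lambda>x. B x + 100 + 32 * K x)"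
    by (rule knows_mono) simp
  then show ?thesis
  proof (rule knows_determined)
    fix x y v
    assume xy: "x \<in> X" "y \<in> X"
      and eq: "(F x v, {(a, b). \<exists>u<net x. (a, b, v) \<in> set (ms2 x u)})
        = (F y v, {(a, b). \<exists>u<net y. (a, b, v) \<in> set (ms2 y u)})"
    have "(\<exists>u<net z. t \<in> set (ms2 z u)) \<longleftrightarrow> (\<exists>u<net z. t \<in> set (ms z u))" if "z \<in> X" for z t
    proof -
      have "(\<Union>u<net z. set (ms2 z u)) = (\<Union>u<net z. set (ms z u))"
        using arg_cong[OF ms2_mset[OF that], where f = set_mset] by (simp add: set_mset_sum)
      then have "t \<in> (\<Union>u<net z. set (ms2 z u)) \<longleftrightarrow> t \<in> (\<Union>u<net z. set (ms z u))"
        by simp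
      then show ?thesis by (simp add: Bex_def)
    qed
    with eq xy show "(F x v, {(a, b). \<exists>u<net x. (a, b, v) \<in> set (ms x u)})
        = (F y v, {(a, b). \<exists>u<net y. (a, b, v) \<in> set (ms y u)})"
      by simp
  qed
qed

end

section \<open>Load balancing by dealing items cyclically\<close>

lemma sum_card_shifted_residues:
  fixes N :: nat
  shows
  "(\<Sum>u<N. card {i. i < l u \<and> ((\<Sum>w<u. l w) + i) mod n = y}) = card {r. r < (\<Sum>u<N. l u) \<and> r mod n = (y::nat)}"
proof (induction N)
  case (Suc N)
  let ?S = "\<Sum>u<N. l u"
  have "{r. r < ?S + l N \<and> r mod n = y} = {r. r < ?S \<and> r mod n = y} \<union> (+) ?S ` {i. i < l N \<and> (?S + i) mod n = y}"
    (is "?L = ?A \<union> ?B")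
  proof (intro set_eqI iffI)
    fix r assume r: "r \<in> ?L"
    show "r \<in> ?A \<union> ?B"
    proof (cases "r < ?S")
      case False
      then obtain i where "r = ?S + i" using le_Suc_ex not_less by blast
      with r show ?thesis by auto
    qed (use r in auto)
  qed auto
  moreover have "card (?A \<union> ?B) = card ?A + card ?B"
    by (intro card_Un_disjoint) auto
  moreover have "card ?B = card {i. i < l N \<and> (?S + i) mod n = y}"
    by (intro card_image) simp
  ultimately show ?case using Suc by simp
qed simp

lemma card_shifted_residues_le_1:
  assumes "l \<le> n"
  shows "card {i. i < l \<and> (s + i) mod n = (y::nat)} \<le> 1"
proof -
  have *: "i = j" if "i \<le> j" "j < n" "(s + i) mod n = (s + j) mod n" for i j
  proof -
    have "n dvd (s + j) - (s + i)"
      using that mod_eq_dvd_iff_nat[of "s + i" "s + j" n] by simp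
    then have "n dvd j - i" by simp
    with that show ?thesis by (auto dest: dvd_imp_le)
  qed
  have "i = j" if "i < n" "j < n" "(s + i) mod n = (s + j) mod n" for i j
    using *[of i j] *[of j i] that by (cases "i \<le> j") auto
  then have "card {i. i < l \<and> (s + i) mod n = y} \<le> Suc 0"
    using assms by (subst card_le_Suc0_iff_eq) auto
  then show ?thesis by simp
qed

context clique_inputs
begin

text \<open>Once all list lengths are broadcast, prefix sums number the items of all nodes
  consecutively, and item r goes to node r mod n. Every node thus holds one residue class. A node
  owns at most n consecutive numbers, so it sends at most one item over each link. Broadcast and
  dealing take two rounds each, including the agreement on their length.\<close>

lemma knows_load_balancing:
  assumes start: "knows (\<lambda>x u. (F x u, es x u)) B"
    and len: "\<And>x u. x \<in> X \<Longrightarrow> u < net x \<Longrightarrow> length (es x u) \<le> net x"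
    and bnd: "\<And>x u t. x \<in> X \<Longrightarrow> u < net x \<Longrightarrow> t \<in> set (es x u) \<Longrightarrow> packet_bounded (net x ^ Suc d) t"
  obtains held where "knows (\<lambda>x y. (F x y, held x y)) (\<lambda>x. B x + 4)"
    and "\<And>x. x \<in> X \<Longrightarrow> (\<Sum>y<net x. mset (held x y)) = (\<Sum>u<net x. mset (es x u))"
    and "\<And>x y. x \<in> X \<Longrightarrow> length (held x y) \<le> (\<Sum>u<net x. length (es x u)) div net x + 1"
proof -
  define off where "off x u = (\<Sum>w<u. length (es x w))" for x u
  \<comment> \<open>With a single class the rank in \<open>spread\<close> is the position in the
    list, and the colour is the receiver.\<close>
  define msg where "msg x u = spread 1 (\<lambda>_. 0) (es x u) (\<lambda>_ i. (off x u + i) mod net x)" for x u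
  define held where "held x y = concat (map (\<lambda>u. msg x u y) [0..<net x])" for x y
  have n: "net x > 0" if "x \<in> X" for x using net_ge_2[OF that] by simp
  have one: "1 \<le> net x ^ Suc d" if "x \<in> X" for x using n[OF that] by simp
  have len_d: "length (es x u) \<le> net x ^ Suc d" if "x \<in> X" "u < net x" for x u
    using len[OF that] mult_le_mono2[of 1 "net x ^ d" "net x"] n[OF that(1)]
    by (auto intro: order.trans)
  have "knows (\<lambda>x u. ((F x u, es x u), \<lambda>v. [(length (es x u), 0, 0)] :: packet list)) B"
    by (rule knows_determined[OF start]) simp
  then have "knows (\<lambda>x v. ((F x v, es x v), \<lambda>u. if u < net x then [(length (es x u), 0, 0)] else [] :: packet list))
      (\<lambda>x. B x + 1 + 1)"
    by (rule knows_stage[where d = "Suc d"]) (use one len_d in \<open>auto simp: packet_bounded_def simp del: power_Suc\<close>)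
  then have "knows (\<lambda>x u. (F x u, msg x u)) (\<lambda>x. B x + 1 + 1)"
  proof (rule knows_determined)
    fix x y v
    assume v: "v < net x" and n: "net y = net x" and eq: "((F x v, es x v), \<lambda>u. if u < net x then [(length (es x u), 0, 0)] else [] :: packet list)
      = ((F y v, es y v), \<lambda>u. if u < net y then [(length (es y u), 0, 0)] else [] :: packet list)"
    then have "length (es x u) = length (es y u)" if "u < net x" for u
      using that by (auto simp: fun_eq_iff dest!: spec[of _ u])
    then have "off x v = off y v"
      unfolding off_def using v by (intro sum.cong) auto
    with eq n show "(F x v, msg x v) = (F y v, msg y v)"
      by (simp add: msg_def)
  qed
  then have "knows (\<lambda>x y. (F x y, \<lambda>u. if u < net x then msg x u y else [])) (\<lambda>x. B x + 1 + 1 + 1 + 1)"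
  proof (rule knows_stage[where d = "Suc d"])
    fix x u y assume x: "x \<in> X" and u: "u < net x"
    show "length (msg x u y) \<le> 1"
      using card_shifted_residues_le_1[OF len[OF x u]]
      by (simp add: msg_def length_spread count_class_def)
    show "packet_bounded (net x ^ Suc d) t" if "t \<in> set (msg x u y)" for t
      using that unfolding msg_def by (intro bnd[OF x u]) (rule subsetD[OF set_spread])
  qed (use one in auto)
  then have "knows (\<lambda>x y. (F x y, held x y)) (\<lambda>x. B x + 1 + 1 + 1 + 1)"
  proof (rule knows_determined)
    fix x y v
    assume n: "net y = net x" and "(F x v, \<lambda>u. if u < net x then msg x u v else [])
      = (F y v, \<lambda>u. if u < net y then msg y u v else [])"
    then have "F x v = F y v" and "\<And>u. u < net x \<Longrightarrow> msg x u v = msg y u v"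
      by (auto simp: fun_eq_iff) (metis+)
    then show "(F x v, held x v) = (F y v, held y v)"
      using n by (auto simp: held_def intro!: arg_cong[where f = concat])
  qed
  then have 1: "knows (\<lambda>x y. (F x y, held x y)) (\<lambda>x. B x + 4)"
    by (rule knows_mono) simp
  have 2: "(\<Sum>y<net x. mset (held x y)) = (\<Sum>u<net x. mset (es x u))" if "x \<in> X" for x
    unfolding held_def mset_concat_upt
    by (subst sum.swap) (use n[OF that] in \<open>simp add: msg_def mset_spread\<close>)
  have 3: "length (held x y) \<le> (\<Sum>u<net x. length (es x u)) div net x + 1" if "x \<in> X" for x y
  proof -
    have "length (held x y) = (\<Sum>u<net x. card {i. i < length (es x u) \<and> (off x u + i) mod net x = y})"
      by (simp add: held_def length_concat o_def sum_list_upt msg_def length_spread count_class_def)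
    also have "\<dots> = card {r. r < (\<Sum>u<net x. length (es x u)) \<and> r mod net x = y}"
      unfolding off_def by (rule sum_card_shifted_residues)
    finally show ?thesis
      using card_residue_le[OF n[OF that]] by simp
  qed
  show ?thesis using that 1 2 3 by blast
qed

end

section \<open>Leaves of a partition tree\<close>

text \<open>A leaf is a part of a leaf node, that is, a path with one part for each of the p depths;
  its index tuple is one longer than that of the tree node.\<close>

definition leaves :: "nat \<Rightarrow> ptree \<Rightarrow> nat list set" where
  "leaves p T = {l. length l = p \<and> (\<forall>i<p. l ! i < length (T (take i l)))}"

definition part :: "ptree \<Rightarrow> nat list \<Rightarrow> nat \<Rightarrow> nat set" where
  "part T l i = T (take i l) ! (l ! i)"

definition back_pairs :: "nat \<Rightarrow> ugraph \<Rightarrow> (nat \<times> nat) set" where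
  "back_pairs p H = {(i, t). t < i \<and> i < p \<and> {i, t} \<in> edges H}"

text \<open>A fixed choice that depends only on n, p and the tree, so every node knows which path is
  assigned to whom.\<close>

definition host :: "nat \<Rightarrow> nat \<Rightarrow> ptree \<Rightarrow> nat list \<Rightarrow> nat" where
  "host n p T = (SOME f. inj_on f (leaves p T) \<and> f ` leaves p T \<subseteq> {..<n})"

text \<open>Symmetric in \<open>a\<close> and \<open>b\<close>: edges of G are stored with the
  smaller end first, whereas the order of the parts comes from the numbering of H.\<close>

definition needs :: "nat \<Rightarrow> ugraph \<Rightarrow> ptree \<Rightarrow> nat \<Rightarrow> nat \<Rightarrow> nat \<Rightarrow> bool" where
  "needs n H T v a b \<longleftrightarrow> (\<exists>l\<in>leaves (card (verts H)) T. host n (card (verts H)) T l = v \<and>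
     (\<exists>(i, t)\<in>back_pairs (card (verts H)) H.
        a \<in> part T l i \<and> b \<in> part T l t \<or> b \<in> part T l i \<and> a \<in> part T l t))"

lemma take_leaf_node:
  assumes "l \<in> leaves p T" "i < p"
  shows "take i l \<in> tree_nodes p T" "l ! i < length (T (take i l))"
  using assms by (auto simp: leaves_def tree_nodes_def min_def)

lemma leaves_subset:
  assumes "partition_tree p x V T"
  shows "leaves p T \<subseteq> {l. set l \<subseteq> {..<x} \<and> length l = p}"
proof
  fix l assume l: "l \<in> leaves p T"
  have "l ! i < x" if "i < p" for i
    using take_leaf_node[OF l that] assms unfolding partition_tree_def by fastforce
  with l show "l \<in> {l. set l \<subseteq> {..<x} \<and> length l = p}"
    by (auto simp: leaves_def in_set_conv_nth)
qed

lemma finite_leaves: "partition_tree p x V T \<Longrightarrow> finite (leaves p T)"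
  by (rule finite_subset[OF leaves_subset]) (auto simp: finite_lists_length_eq)

lemma card_leaves_le: "partition_tree p x V T \<Longrightarrow> card (leaves p T) \<le> x ^ p"
  using card_mono[OF _ leaves_subset, of x p V T]
  by (simp add: card_lists_length_eq finite_lists_length_eq)

lemma host:
  assumes "partition_tree p x V T" "x ^ p \<le> n"
  shows "inj_on (host n p T) (leaves p T)" "host n p T ` leaves p T \<subseteq> {..<n}"
proof -
  have "card (leaves p T) \<le> card {..<n}"
    using card_leaves_le[OF assms(1)] assms(2) by simp
  then obtain f where f: "inj_on f (leaves p T) \<and> f ` leaves p T \<subseteq> {..<n}"
    using card_le_inj[OF finite_leaves[OF assms(1)]] by (metis finite_lessThan)
  define P where "P f \<longleftrightarrow> inj_on f (leaves p T) \<and> f ` leaves p T \<subseteq> {..<n}" for f :: "nat list \<Rightarrow> nat"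
  have "P (host n p T)"
    unfolding host_def P_def[symmetric] using f by (intro someI[of P]) (simp add: P_def)
  then show "inj_on (host n p T) (leaves p T)" "host n p T ` leaves p T \<subseteq> {..<n}"
    by (simp_all add: P_def)
qed

section \<open>Counting the edges that have to be sent and received\<close>

lemma card_edge_pairs_le:
  assumes "finite E" "\<And>i t. (i, t) \<in> P \<Longrightarrow> (t::nat) < i \<and> {i, t} \<in> E"
  shows "finite P" "card P \<le> card E"
proof -
  have inj: "inj_on (\<lambda>(i, t). {i, t}) P"
    by (auto simp: inj_on_def doubleton_eq_iff) (metis assms(2) less_asym)+
  have sub: "(\<lambda>(i, t). {i, t}) ` P \<subseteq> E"
    using assms(2) by auto
  show "finite P" "card P \<le> card E"
    using inj_on_finite[OF inj sub assms(1)] card_inj_on_le[OF inj sub assms(1)] by auto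
qed

lemma finite_edges: "simple_graph G \<Longrightarrow> finite (edges G)"
  unfolding simple_graph_def by (meson Pow_iff finite_Pow_iff finite_subset subsetI)

lemma card_back_pairs_le:
  "simple_graph H \<Longrightarrow> finite (back_pairs p H) \<and> card (back_pairs p H) \<le> card (edges H)"
  using card_edge_pairs_le[OF finite_edges, of H "back_pairs p H"] by (auto simp: back_pairs_def)

text \<open>The coordinates \<open>i\<close> and \<open>t\<close> of a leaf are determined by the other ones: the nodes \<open>b\<close>
  and \<open>a\<close> single out one part of the partitions at depths \<open>t\<close> and \<open>i\<close>.\<close>

lemma card_leaves_through_le:
  assumes T: "partition_tree p x V T" and "t < i" "i < p"
  shows "card {l\<in>leaves p T. a \<in> part T l i \<and> b \<in> part T l t} \<le> x ^ (p - 2)"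
proof -
  let ?S = "{l\<in>leaves p T. a \<in> part T l i \<and> b \<in> part T l t}" and ?I = "{..<p} - {i, t}"
  have same: "l ! j = l' ! j" if l: "l \<in> leaves p T" "l' \<in> leaves p T" "j < p" "take j l = take j l'"
      "c \<in> part T l j" "c \<in> part T l' j" for l l' j c
  proof (rule ccontr)
    assume "l ! j \<noteq> l' ! j"
    moreover have "is_partition V (T (take j l))"
      using T take_leaf_node(1)[OF l(1,3)] by (auto simp: partition_tree_def)
    ultimately have "T (take j l) ! (l ! j) \<inter> T (take j l) ! (l' ! j) = {}"
      using take_leaf_node(2)[OF l(1,3)] take_leaf_node(2)[OF l(2,3)] l(4)
      unfolding is_partition_def disjoint_family_on_def by auto
    then show False using l(4-6) by (auto simp: part_def)
  qed
  have "inj_on (\<lambda>l. restrict ((!) l) ?I) ?S"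
  proof (rule inj_onI)
    fix l l' assume l: "l \<in> ?S" "l' \<in> ?S" and eq: "restrict ((!) l) ?I = restrict ((!) l') ?I"
    have len: "length l = p" "length l' = p" using l by (auto simp: leaves_def)
    have "l ! j = l' ! j" if "j < p" for j
      using that
    proof (induction j rule: less_induct)
      case (less j)
      then have "take j l = take j l'"
        using len by (auto simp: list_eq_iff_nth_eq)
      then show ?case
        using same[of l l' j a] same[of l l' j b] l less.prems fun_cong[OF eq, of j]
        by (cases "j = i \<or> j = t") auto
    qed
    then show "l = l'" using len by (simp add: list_eq_iff_nth_eq)
  qed
  moreover have "(\<lambda>l. restrict ((!) l) ?I) ` ?S \<subseteq> (\<Pi>\<^sub>E j\<in>?I. {..<x})"
  proof clarify
    fix l assume "l \<in> leaves p T"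
    then have "set l \<subseteq> {..<x}" "length l = p" using leaves_subset[OF T] by auto
    then show "restrict ((!) l) ?I \<in> (\<Pi>\<^sub>E j\<in>?I. {..<x})"
      by (auto dest: nth_mem)
  qed
  moreover have "finite (\<Pi>\<^sub>E j\<in>?I. {..<x})"
    by (intro finite_PiE) auto
  ultimately have "card ?S \<le> card (\<Pi>\<^sub>E j\<in>?I. {..<x})"
    by (rule card_inj_on_le)
  also have "\<dots> = x ^ (p - 2)"
    using assms(2,3) by (simp add: card_PiE card_Diff_subset numeral_2_eq_2)
  finally show ?thesis .
qed

text \<open>For each edge of H, {a, b} can be matched in two orientations, and each of them leaves
  at most x^(p-2) paths by \<open>card_leaves_through_le\<close>.\<close>

lemma card_needs_le:
  assumes T: "partition_tree p x V T" and H: "simple_graph H" "card (verts H) = p"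
  shows "card {v. needs n H T v a b} \<le> 2 * card (edges H) * x ^ (p - 2)"
proof -
  let ?S = "\<lambda>i t a b. {l\<in>leaves p T. a \<in> part T l i \<and> b \<in> part T l t}"
  let ?U = "\<Union>(i, t)\<in>back_pairs p H. ?S i t a b \<union> ?S i t b a"
  have fin: "finite (?S i t a b)" for i t a b
    using finite_leaves[OF T] by simp
  have P: "finite (back_pairs p H)" "card (back_pairs p H) \<le> card (edges H)"
    using card_back_pairs_le[OF H(1)] by auto
  have finU: "finite ?U"
    using fin P(1) by (intro finite_UN_I) auto
  have "{v. needs n H T v a b} \<subseteq> host n p T ` ?U"
    unfolding needs_def H(2) by blast
  then have "card {v. needs n H T v a b} \<le> card (host n p T ` ?U)"
    using finU by (intro card_mono) auto
  also have "\<dots> \<le> card ?U"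
    by (rule card_image_le[OF finU])
  also have "\<dots> \<le> (\<Sum>(i, t)\<in>back_pairs p H. card (?S i t a b \<union> ?S i t b a))"
    using card_UN_le[OF P(1), of "\<lambda>(i, t). ?S i t a b \<union> ?S i t b a"] by (simp add: case_prod_unfold)
  also have "\<dots> \<le> (\<Sum>(i, t)\<in>back_pairs p H. 2 * x ^ (p - 2))"
  proof (rule sum_mono, clarify)
    fix i t assume "(i, t) \<in> back_pairs p H"
    then have "card (?S i t a b) \<le> x ^ (p - 2)" "card (?S i t b a) \<le> x ^ (p - 2)"
      by (auto simp: back_pairs_def intro!: card_leaves_through_le[OF T])
    then show "card (?S i t a b \<union> ?S i t b a) \<le> 2 * x ^ (p - 2)"
      using card_Un_le[of "?S i t a b" "?S i t b a"] by linarith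
  qed
  also have "\<dots> \<le> 2 * card (edges H) * x ^ (p - 2)"
    using P(2) by (simp add: case_prod_unfold)
  finally show ?thesis .
qed

text \<open>Every edge of H is counted at its larger end only.\<close>

lemma sum_back_degree_le:
  assumes "simple_graph H"
  shows "(\<Sum>i<p. back_degree H i) \<le> card (edges H)"
proof -
  let ?D = "\<lambda>i. {{i, t} | t. t < i \<and> {i, t} \<in> edges H}"
  have fin: "finite (?D i)" for i
    by (rule finite_subset[OF _ finite_edges[OF assms]]) auto
  have "(\<Sum>i<p. back_degree H i) = card (\<Union>i<p. ?D i)"
    unfolding back_degree_def using fin
    by (subst card_UN_disjoint) (auto simp: doubleton_eq_iff dest: less_asym)
  also have "\<dots> \<le> card (edges H)"
    by (intro card_mono finite_edges assms) auto
  finally show ?thesis .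
qed

lemma edges_betweenI:
  "a \<in> A \<Longrightarrow> b \<in> B \<Longrightarrow> {a, b} \<in> edges G \<Longrightarrow> {a, b} \<in> edges_between G A B"
  unfolding edges_between_def by blast

text \<open>The node \<open>v\<close> serves at most one path because \<open>host\<close> is
  injective. The second tree condition, summed over the p depths of this path, gives the bound: back
  degrees add up to at most k and the summands \<open>+ n\<close> to p n. The absolute value covers
  negative \<open>c2\<close>.\<close>

lemma card_needed_edges_le:
  assumes T: "H_partition_tree c1 c2 p x H G T" and "x ^ p \<le> card (verts G)"
    and G: "simple_graph G" and H: "simple_graph H" "card (verts H) = p"
    and n: "card (verts G) = n" and m: "card (edges G) = m" and k: "card (edges H) = k"
  shows "real (card {(a, b). a < b \<and> {a, b} \<in> edges G \<and> needs n H T v a b})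
    \<le> \<bar>c2\<bar> * real k * m_tilde n m x / (real x)\<^sup>2 + real p * real n"
    (is "real (card ?N) \<le> ?R")
proof (cases "\<exists>l\<in>leaves p T. host n p T l = v")
  case False
  then have "?N = {}" by (auto simp: needs_def H(2))
  moreover have "?R \<ge> 0" by (auto simp: m_tilde_def intro!: add_nonneg_nonneg divide_nonneg_nonneg mult_nonneg_nonneg)
  ultimately show ?thesis by (metis card.empty of_nat_0)
next
  case True
  then obtain l where l: "l \<in> leaves p T" "host n p T l = v" by blast
  have pt: "partition_tree p x (verts G) T"
    using T by (simp add: H_partition_tree_def Let_def)
  have uniq: "l' = l" if "l' \<in> leaves p T" "host n p T l' = v" for l'
    using host(1)[OF pt assms(2)] that l n by (auto dest: inj_onD)
  let ?E = "\<lambda>i t. edges_between G (part T l i) (part T l t)"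
  let ?t = "\<lambda>i. {t. t < i \<and> {i, t} \<in> edges H}"
  have finE: "finite (?E i t)" for i t
    by (rule finite_subset[OF _ finite_edges[OF G]]) (auto simp: edges_between_def)
  have fint: "finite (?t i)" for i by simp
  have "card ?N \<le> card (\<Union>i<p. \<Union>t\<in>?t i. ?E i t)"
  proof (rule card_inj_on_le)
    show "inj_on (\<lambda>(a, b). {a, b}) ?N"
      by (auto simp: inj_on_def doubleton_eq_iff dest: less_asym)
    show "(\<lambda>(a, b). {a, b}) ` ?N \<subseteq> (\<Union>i<p. \<Union>t\<in>?t i. ?E i t)"
    proof clarify
      fix a b assume ab: "{a, b} \<in> edges G" and "needs n H T v a b"
      then obtain i t where "(i, t) \<in> back_pairs p H"
        "a \<in> part T l i \<and> b \<in> part T l t \<or> b \<in> part T l i \<and> a \<in> part T l t"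
        using uniq unfolding needs_def H(2) by blast
      then have "{a, b} \<in> ?E i t" "i < p" "t \<in> ?t i"
        using ab edges_betweenI[of a "part T l i" b "part T l t" G] edges_betweenI[of b "part T l i" a "part T l t" G]
        by (auto simp: back_pairs_def insert_commute)
      then show "{a, b} \<in> (\<Union>i<p. \<Union>t\<in>?t i. ?E i t)" by blast
    qed
    show "finite (\<Union>i<p. \<Union>t\<in>?t i. ?E i t)"
      using finE fint by (intro finite_UN_I) auto
  qed
  also have "\<dots> \<le> (\<Sum>i<p. \<Sum>t\<in>?t i. card (?E i t))"
    by (rule order.trans[OF card_UN_le sum_mono]) (auto intro: card_UN_le)
  finally have "real (card ?N) \<le> (\<Sum>i<p. \<Sum>t\<in>?t i. real (card (?E i t)))"
    by (simp flip: of_nat_sum)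
  also have "\<dots> \<le> (\<Sum>i<p. \<bar>c2\<bar> * real (back_degree H i) * m_tilde n m x / (real x)\<^sup>2 + real n)"
  proof (rule sum_mono)
    fix i assume "i \<in> {..<p}"
    then have i: "i < p" by simp
    have len: "length l = p" using l by (simp add: leaves_def)
    \<comment> \<open>The depth-i part of the path is the part \<open>l ! i\<close> of the tree node
      \<open>take i l\<close>, to which the tree condition refers.\<close>
    have anc: "ancestor T (take i l) (l ! i) t = part T l t" if "t \<le> i" for t
      using that i len by (auto simp: ancestor_def part_def nth_append min_def take_Suc_conv_app_nth[symmetric])
    have "(\<Sum>t\<in>?t i. real (card (?E i t))) = (\<Sum>t\<in>?t i. real (card (edges_between G
        (ancestor T (take i l) (l ! i) i) (ancestor T (take i l) (l ! i) t))))"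
      by (intro sum.cong) (auto simp: anc)
    also have "\<dots> \<le> c2 * real (back_degree H i) * m_tilde n m x / (real x)\<^sup>2 + real n"
      using T take_leaf_node[OF l(1) i] len i unfolding H_partition_tree_def Let_def n m by auto
    also have "\<dots> \<le> \<bar>c2\<bar> * real (back_degree H i) * m_tilde n m x / (real x)\<^sup>2 + real n"
      by (auto simp: m_tilde_def intro!: add_right_mono divide_right_mono mult_right_mono)
    finally show "(\<Sum>t\<in>?t i. real (card (?E i t)))
      \<le> \<bar>c2\<bar> * real (back_degree H i) * m_tilde n m x / (real x)\<^sup>2 + real n" .
  qed
  also have "\<dots> = \<bar>c2\<bar> * real (\<Sum>i<p. back_degree H i) * m_tilde n m x / (real x)\<^sup>2 + real p * real n"
    by (simp add: sum.distrib sum_distrib_left sum_distrib_right sum_divide_distrib)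
  also have "\<dots> \<le> ?R"
    using sum_back_degree_le[OF H(1), of p] k
    by (auto simp: m_tilde_def intro!: divide_right_mono mult_right_mono mult_left_mono simp flip: of_nat_sum)
  finally show ?thesis .
qed

text \<open>Every embedding of \<open>H\<close> descends along the tree to a leaf: in the partition of each node,
  follow the part that contains the image of the next node of \<open>H\<close>.\<close>

lemma leaf_of_embedding:
  assumes T: "partition_tree p x V T" and f: "\<And>i. i < p \<Longrightarrow> f i \<in> V"
  obtains l where "l \<in> leaves p T" "\<And>i. i < p \<Longrightarrow> f i \<in> part T l i"
proof -
  have "\<exists>l. length l = q \<and> (\<forall>i<q. l ! i < length (T (take i l)) \<and> f i \<in> part T l i)" if "q \<le> p" for q
    using that
  proof (induction q)
    case (Suc q)
    then obtain l where l: "length l = q" "\<And>i. i < q \<Longrightarrow> l ! i < length (T (take i l)) \<and> f i \<in> part T l i"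
      by auto
    then have "l \<in> tree_nodes p T"
      using Suc.prems by (auto simp: tree_nodes_def)
    then have "\<Union> (set (T l)) = V"
      using T by (auto simp: partition_tree_def is_partition_def)
    then obtain j where j: "j < length (T l)" "f q \<in> T l ! j"
      using f[of q] Suc.prems by (auto simp: in_set_conv_nth)
    have "(l @ [j]) ! i < length (T (take i (l @ [j]))) \<and> f i \<in> part T (l @ [j]) i" if "i < Suc q" for i
      using that l j by (cases "i = q") (auto simp: part_def nth_append)
    with l(1) show ?case by (intro exI[of _ "l @ [j]"]) auto
  qed simp
  from this[of p] show ?thesis
    using that by (auto simp: leaves_def)
qed

section \<open>The listing algorithm\<close>

text \<open>Only the structure of the tree is assumed here and none of its edge bounds: correctness
  holds for all these instances, and the bounds enter only when rounds are counted. This makes the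
  algorithm independent of \<open>c1\<close> and \<open>c2\<close>.\<close>

definition listing_inputs :: "(ugraph \<times> ugraph \<times> ptree) set" where
  "listing_inputs = {(G, H, T). \<exists>n p. simple_graph G \<and> verts G = {..<n} \<and> 2 \<le> n \<and>
     simple_graph H \<and> verts H = {..<p} \<and> branching n p ^ p \<le> n \<and>
     partition_tree p (branching n p) (verts G) T}"

definition input_size :: "ugraph \<times> ugraph \<times> ptree \<Rightarrow> nat" where
  "input_size = (\<lambda>(G, H, T). card (verts G))"

definition node_inputs :: "ugraph \<times> ugraph \<times> ptree \<Rightarrow> nat \<Rightarrow> node_input" where
  "node_inputs = (\<lambda>(G, H, T). graph_input G H T)"

lemma clique_inputs_listing: "clique_inputs listing_inputs input_size node_inputs"
  by unfold_locales (auto simp: listing_inputs_def input_size_def node_inputs_def graph_input_def)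

text \<open>Each edge starts at its smaller end only, so no edge is sent twice.\<close>

definition upper_edges :: "ugraph \<Rightarrow> nat \<Rightarrow> nat list" where
  "upper_edges G u = sorted_list_of_set {w. u < w \<and> {u, w} \<in> edges G}"

lemma finite_upper: "simple_graph G \<Longrightarrow> finite {w. u < w \<and> {u, w} \<in> edges G}"
  by (rule finite_subset[of _ "verts G"]) (auto simp: simple_graph_def)

lemma length_upper_edges_le:
  assumes "simple_graph G"
  shows "length (upper_edges G u) \<le> card (verts G)"
proof -
  have "card {w. u < w \<and> {u, w} \<in> edges G} \<le> card (verts G)"
    using assms by (intro card_mono) (auto simp: simple_graph_def)
  then show ?thesis by (simp add: upper_edges_def)
qed

lemma sum_filter_upper_edges:
  assumes "simple_graph G" "verts G = {..<n}"
  shows "(\<Sum>u<n. length (filter (P u) (upper_edges G u))) = card {(a, b). a < b \<and> {a, b} \<in> edges G \<and> P a b}"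
proof -
  have "length (filter (P u) (upper_edges G u)) = card {w. u < w \<and> {u, w} \<in> edges G \<and> P u w}" for u
  proof -
    have "length (filter (P u) (upper_edges G u)) = card (set (filter (P u) (upper_edges G u)))"
      by (intro distinct_card[symmetric]) (simp add: upper_edges_def)
    also have "set (filter (P u) (upper_edges G u)) = {w. u < w \<and> {u, w} \<in> edges G \<and> P u w}"
      using finite_upper[OF assms(1)] by (auto simp: upper_edges_def)
    finally show ?thesis .
  qed
  then have "(\<Sum>u<n. length (filter (P u) (upper_edges G u)))
      = card (SIGMA u:{..<n}. {w. u < w \<and> {u, w} \<in> edges G \<and> P u w})"
    using finite_upper[OF assms(1)] by (subst card_SigmaI) (auto intro: rev_finite_subset)
  also have "(SIGMA u:{..<n}. {w. u < w \<and> {u, w} \<in> edges G \<and> P u w})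
      = {(a, b). a < b \<and> {a, b} \<in> edges G \<and> P a b}"
    using assms by (auto simp: simple_graph_def)
  finally show ?thesis .
qed

lemma card_upper_edges_le:
  assumes "simple_graph G"
  shows "card {(a, b). a < b \<and> {a, b} \<in> edges G} \<le> card (edges G)"
proof -
  have "card {(a, b). a < b \<and> {a, b} \<in> edges G} = card (prod.swap ` {(a, b). a < b \<and> {a, b} \<in> edges G})"
    by (rule card_image[symmetric]) simp
  also have "\<dots> \<le> card (edges G)"
    by (rule card_edge_pairs_le[OF finite_edges[OF assms]]) (auto simp: insert_commute)
  finally show ?thesis .
qed

text \<open>All vertices are kept: they are known to every node, and copies of an H with isolated
  nodes must be found as well.\<close>

definition local_graph :: "ugraph \<times> ugraph \<times> ptree \<Rightarrow> nat \<Rightarrow> ugraph" where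
  "local_graph = (\<lambda>(G, H, T) v. \<lparr>verts = verts G,
     edges = {{a, b} | a b. a < b \<and> {a, b} \<in> edges G \<and> needs (card (verts G)) H T v a b}\<rparr>)"

lemma local_graph_copies:
  assumes "(G, H, T) \<in> listing_inputs"
  shows "(\<Union>v<card (verts G). copies H (local_graph (G, H, T) v)) = copies H G"
proof (intro equalityI subsetI)
  fix S assume "S \<in> (\<Union>v<card (verts G). copies H (local_graph (G, H, T) v))"
  then show "S \<in> copies H G"
    by (force simp: copies_def subgraph_def local_graph_def)
next
  fix S assume S: "S \<in> copies H G"
  obtain f where f: "bij_betw f (verts H) (verts S)" "edges S = (\<lambda>e. f ` e) ` edges H"
    using S by (auto simp: copies_def isomorphic_def)
  obtain n p where np: "verts G = {..<n}" "verts H = {..<p}" and H: "simple_graph H"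
    and T: "partition_tree p (branching n p) (verts G) T" and pow: "branching n p ^ p \<le> n"
    using assms by (auto simp: listing_inputs_def)
  have fV: "f i \<in> verts G" if "i < p" for i
    using that f(1) np(2) S by (auto simp: bij_betw_def copies_def subgraph_def)
  obtain l where l: "l \<in> leaves p T" "\<And>i. i < p \<Longrightarrow> f i \<in> part T l i"
    using leaf_of_embedding[OF T, of f] fV by blast
  define v where "v = host n p T l"
  have v: "v < n"
    using host(2)[OF T pow] l(1) by (auto simp: v_def)
  have "e \<in> edges (local_graph (G, H, T) v)" if e: "e \<in> edges S" for e
  proof -
    obtain e' where e': "e' \<in> edges H" "e = f ` e'" using e f(2) by auto
    then have "e' \<subseteq> {..<p}" "card e' = 2"
      using H np(2) by (auto simp: simple_graph_def)
    then obtain a b where ab: "e' = {a, b}" "a \<noteq> b" "a < p" "b < p"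
      by (auto simp: card_2_iff)
    \<comment> \<open>The larger index is put first, as in \<open>back_pairs\<close>.\<close>
    have "\<exists>i t. e' = {i, t} \<and> t < i \<and> i < p"
    proof (cases "a < b")
      case True
      with ab have "e' = {b, a} \<and> a < b \<and> b < p" by auto
      then show ?thesis by blast
    next
      case False
      with ab have "e' = {a, b} \<and> b < a \<and> a < p" by simp
      then show ?thesis by blast
    qed
    then obtain i t where it: "e' = {i, t}" "t < i" "i < p" by blast
    have "i \<in> verts H" "t \<in> verts H" using it np(2) by auto
    then have "f i \<noteq> f t"
      using it f(1) by (auto simp: bij_betw_def dest: inj_onD)
    moreover have "{f i, f t} \<in> edges G"
      using e S e' it by (auto simp: copies_def subgraph_def)
    moreover have "(i, t) \<in> back_pairs p H"
      using e'(1) it by (simp add: back_pairs_def)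
    then have "needs n H T v (f i) (f t)" "needs n H T v (f t) (f i)"
      unfolding needs_def v_def np card_lessThan
      by (intro bexI[of _ l] conjI bexI[of _ "(i, t)"]; use l it in simp)+
    ultimately show ?thesis
      using e' it np(1) by (cases "f i < f t") (auto simp: local_graph_def insert_commute)
  qed
  then have "S \<in> copies H (local_graph (G, H, T) v)"
    using S by (auto simp: copies_def subgraph_def local_graph_def)
  with v np(1) show "S \<in> (\<Union>v<card (verts G). copies H (local_graph (G, H, T) v))" by auto
qed

lemma length_concat_le:
  "(\<And>x. x \<in> set xs \<Longrightarrow> length (f x) \<le> D) \<Longrightarrow> length (concat (map f xs)) \<le> length xs * D"
proof (induction xs)
  case (Cons x xs)
  then show ?case using add_mono[of "length (f x)" D] by simp
qed simp

lemma listing_inputsD: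
  assumes "x \<in> listing_inputs"
  shows "simple_graph (fst x)" "verts (fst x) = {..<input_size x}"
proof -
  obtain G H T where x: "x = (G, H, T)" by (rule prod_cases3)
  obtain n where "simple_graph G" "verts G = {..<n}"
    using assms unfolding x listing_inputs_def by blast
  then show "simple_graph (fst x)" "verts (fst x) = {..<input_size x}"
    by (simp_all add: x input_size_def)
qed

text \<open>\<open>K x\<close> bounds the number of packets per node that have to be routed, in units of \<open>n\<close>.\<close>

lemma knows_listing:
  obtains K where
    "clique_inputs.knows listing_inputs input_size node_inputs
       (\<lambda>x v. copies (fst (snd x)) (local_graph x v)) (\<lambda>x. 104 + 32 * K x)"
    and "\<And>G H T M. (G, H, T) \<in> listing_inputs \<Longrightarrow>
      (card (edges G) div card (verts G) + 1) * (2 * card (edges H) *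
        branching (card (verts G)) (card (verts H)) ^ (card (verts H) - 2)) \<le> card (verts G) * M \<Longrightarrow>
      (\<And>v. card {(a, b). a < b \<and> {a, b} \<in> edges G \<and> needs (card (verts G)) H T v a b}
        \<le> card (verts G) * M) \<Longrightarrow> K (G, H, T) \<le> M"
proof -
  interpret clique_inputs listing_inputs input_size node_inputs
    by (rule clique_inputs_listing)
  define es :: "ugraph \<times> ugraph \<times> ptree \<Rightarrow> nat \<Rightarrow> packet list" where
    "es x u = map (\<lambda>w. (u, w, 0)) (upper_edges (fst x) u)" for x u
  define need where "need x v a b = needs (input_size x) (fst (snd x)) (snd (snd x)) v a b" for x v a b
  have simple: "simple_graph (fst x)" and VG: "verts (fst x) = {..<input_size x}" if "x \<in> listing_inputs" for x
    using listing_inputsD[OF that] by auto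
  have in_es: "(a, b, c) \<in> set (es x u) \<longleftrightarrow> a = u \<and> c = 0 \<and> u < b \<and> {u, b} \<in> edges (fst x)"
    if "x \<in> listing_inputs" for x u a b c
    using finite_upper[OF simple[OF that]] by (auto simp: es_def upper_edges_def)
  have verts: "a < input_size x \<and> b < input_size x" if "x \<in> listing_inputs" "{a, b} \<in> edges (fst x)" for x a b
    using simple[OF that(1)] VG[OF that(1)] that(2) by (auto simp: simple_graph_def)
  have len_es: "length (es x u) \<le> input_size x" if "x \<in> listing_inputs" for x u
    using length_upper_edges_le[OF simple[OF that], of u] VG[OF that] by (simp add: es_def)
  have "knows (\<lambda>x u. (node_inputs x u, es x u)) (\<lambda>x. 0)"
  proof (rule knows_determined[OF knows_input])
    fix x y u assume eq: "node_inputs x u = node_inputs y u"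
    then have "incident_edges (fst x) u = incident_edges (fst y) u"
      by (cases x; cases y) (auto simp: node_inputs_def graph_input_def)
    moreover have "upper_edges G u = sorted_list_of_set {w. u < w \<and> {u, w} \<in> incident_edges G u}" for G
      by (simp add: upper_edges_def incident_edges_def)
    ultimately show "(node_inputs x u, es x u) = (node_inputs y u, es y u)"
      using eq by (simp add: es_def)
  qed
  then obtain held where held: "knows (\<lambda>x y. (node_inputs x y, held x y)) (\<lambda>x. 0 + 4)"
    and held_mset: "\<And>x. x \<in> listing_inputs \<Longrightarrow>
      (\<Sum>y<input_size x. mset (held x y)) = (\<Sum>u<input_size x. mset (es x u))"
    and held_len: "\<And>x y. x \<in> listing_inputs \<Longrightarrow>
      length (held x y) \<le> (\<Sum>u<input_size x. length (es x u)) div input_size x + 1"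
  proof (rule knows_load_balancing[where d = 0])
    show "packet_bounded (input_size x ^ Suc 0) t"
      if "x \<in> listing_inputs" "u < input_size x" "t \<in> set (es x u)" for x u t
      using that verts[of x] in_es[OF that(1)] by (cases t) (fastforce simp: packet_bounded_def)
  qed (use len_es in auto)
  define ms where "ms x y = concat (map (\<lambda>(a, b, c). map (\<lambda>v. (a, b, v))
    (filter (\<lambda>v. need x v a b) [0..<input_size x])) (held x y))" for x y
  \<comment> \<open>The actual load of the instance, not an estimate. The constants of the tree come
    in afterwards, through an \<open>M\<close> that bounds both loads and hence
    \<open>K x\<close>.\<close>
  define K where "K x = (LEAST K. (\<forall>y<input_size x. length (ms x y) \<le> input_size x * K) \<and>
    (\<forall>v<input_size x. (\<Sum>u<input_size x. count_class target (ms x u) v) \<le> input_size x * K))" for x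
  have start: "knows (\<lambda>x u. (node_inputs x u, ms x u)) (\<lambda>x. 0 + 4)"
  proof (rule knows_determined[OF held])
    fix x y u
    assume n: "input_size y = input_size x" and eq: "(node_inputs x u, held x u) = (node_inputs y u, held y u)"
    then have "fst (snd x) = fst (snd y)" "snd (snd x) = snd (snd y)"
      by (cases x; cases y; simp add: node_inputs_def graph_input_def)+
    with n have "need x = need y"
      by (simp add: need_def[abs_def])
    with n eq show "(node_inputs x u, ms x u) = (node_inputs y u, ms y u)"
      by (simp add: ms_def)
  qed
  have set_held: "(\<Union>y<input_size x. set (held x y)) = (\<Union>u<input_size x. set (es x u))"
    if "x \<in> listing_inputs" for x
    using arg_cong[OF held_mset[OF that], where f = set_mset] by (simp add: set_mset_sum)
  have in_held: "a < b \<and> c = 0 \<and> {a, b} \<in> edges (fst x)"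
    if "x \<in> listing_inputs" "y < input_size x" "(a, b, c) \<in> set (held x y)" for x y a b c
  proof -
    have "(a, b, c) \<in> (\<Union>y<input_size x. set (held x y))"
      using that(2,3) by auto
    then show ?thesis
      unfolding set_held[OF that(1)] using in_es[OF that(1)] by auto
  qed
  have in_ms: "(a, b, v) \<in> set (ms x y) \<longleftrightarrow>
      v < input_size x \<and> need x v a b \<and> (\<exists>c. (a, b, c) \<in> set (held x y))" for a b v x y
    by (auto simp: ms_def intro!: bexI[of _ "(a, b, _)"])
  have received: "(\<exists>y<input_size x. (a, b, v) \<in> set (ms x y)) \<longleftrightarrow>
      v < input_size x \<and> need x v a b \<and> a < b \<and> {a, b} \<in> edges (fst x)" if x: "x \<in> listing_inputs" for x a b v
  proof
    assume "\<exists>y<input_size x. (a, b, v) \<in> set (ms x y)"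
    then show "v < input_size x \<and> need x v a b \<and> a < b \<and> {a, b} \<in> edges (fst x)"
      using in_ms in_held[OF that] by blast
  next
    assume *: "v < input_size x \<and> need x v a b \<and> a < b \<and> {a, b} \<in> edges (fst x)"
    then have "(a, b, 0) \<in> (\<Union>u<input_size x. set (es x u))"
      using verts[OF that] in_es[OF that] by auto
    then obtain y where "y < input_size x" "(a, b, 0) \<in> set (held x y)"
      unfolding set_held[OF x, symmetric] by auto
    with * in_ms show "\<exists>y<input_size x. (a, b, v) \<in> set (ms x y)" by blast
  qed
  have total: "(\<Sum>u<input_size x. length (es x u)) \<le> card (edges (fst x))" if "x \<in> listing_inputs" for x
    using sum_filter_upper_edges[OF simple[OF that] VG[OF that], of "\<lambda>_ _. True"]
      card_upper_edges_le[OF simple[OF that]] by (simp add: es_def)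
  have out_le: "length (ms x y) \<le> length (held x y) * D"
    if "\<And>a b. card {v. v < input_size x \<and> need x v a b} \<le> D" for x y D
    unfolding ms_def
    by (rule length_concat_le) (use that in \<open>auto simp: length_filter_upt\<close>)
  have count: "count_class target (ms x y) v = length (filter (\<lambda>(a, b, c). need x v a b) (held x y))"
    if "v < input_size x" for x y v
  proof -
    have one: "count_class target (map (\<lambda>v. (a, b, v)) (filter (\<lambda>v. need x v a b) [0..<input_size x])) v
        = (if need x v a b then 1 else 0)" for a b
    proof -
      have "count_class target (map (\<lambda>v. (a, b, v)) (filter (\<lambda>v. need x v a b) [0..<input_size x])) v
          = card {w. w < input_size x \<and> w = v \<and> need x w a b}"
        by (simp add: count_class_def filter_map o_def length_filter_upt)
      also have "{w. w < input_size x \<and> w = v \<and> need x w a b} = (if need x v a b then {v} else {})"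
        using that by auto
      finally show ?thesis by simp
    qed
    have "count_class target (concat (map (\<lambda>(a, b, c). map (\<lambda>v. (a, b, v))
        (filter (\<lambda>v. need x v a b) [0..<input_size x])) ts)) v
        = length (filter (\<lambda>(a, b, c). need x v a b) ts)" for ts :: "packet list"
    proof (induction ts)
      case (Cons t ts)
      obtain a b c where "t = (a, b, c)" by (rule prod_cases3)
      with Cons one[of a b] show ?case by (simp add: count_class_def)
    qed (simp add: count_class_def)
    then show ?thesis by (simp add: ms_def)
  qed
  have into: "(\<Sum>u<input_size x. count_class target (ms x u) v)
      = card {(a, b). a < b \<and> {a, b} \<in> edges (fst x) \<and> need x v a b}"
    if x: "x \<in> listing_inputs" and v: "v < input_size x" for x v
  proof -
    \<comment> \<open>The predicate becomes a two-valued class, so that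
      \<open>sum_count_class_cong\<close> carries the count from the held edges back to the original
      ones.\<close>
    let ?cls = "\<lambda>t. if (case t of (a, b, c) \<Rightarrow> need x v a b) then 1 else 0 :: nat"
    have cls: "length (filter (\<lambda>(a, b, c). need x v a b) ts) = count_class ?cls ts 1" for ts :: "packet list"
      unfolding count_class_def by (intro arg_cong[where f = length] filter_cong) auto
    have "(\<Sum>u<input_size x. count_class target (ms x u) v) = (\<Sum>u<input_size x. count_class ?cls (es x u) 1)"
      unfolding count[OF v] cls by (rule sum_count_class_cong[OF held_mset[OF x]])
    also have "\<dots> = (\<Sum>u<input_size x. length (filter (\<lambda>w. need x v u w) (upper_edges (fst x) u)))"
      unfolding cls[symmetric] by (simp add: es_def filter_map o_def)
    finally show ?thesis
      by (simp add: sum_filter_upper_edges[OF simple[OF x] VG[OF x]])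
  qed
  have K_least: "K x \<le> M"
    if "\<And>y. y < input_size x \<Longrightarrow> length (ms x y) \<le> input_size x * M"
      "\<And>v. v < input_size x \<Longrightarrow> (\<Sum>u<input_size x. count_class target (ms x u) v) \<le> input_size x * M" for x M
    unfolding K_def by (rule Least_le) (intro conjI allI impI that)
  \<comment> \<open>This shows that the least \<open>K\<close> exists and is polynomial in n, as the
    logarithmic bandwidth requires.\<close>
  have crude: "length (ms x y) \<le> input_size x * (input_size x + 1)"
    "v < input_size x \<Longrightarrow> (\<Sum>u<input_size x. count_class target (ms x u) v) \<le> input_size x * (input_size x + 1)"
    if x: "x \<in> listing_inputs" for x y v
  proof -
    have tot: "(\<Sum>u<input_size x. length (es x u)) \<le> input_size x * input_size x"
      using sum_bounded_above[of "{..<input_size x}" "\<lambda>u. length (es x u)" "input_size x"] len_es[OF x] by simp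
    have "length (held x y) \<le> input_size x + 1"
      using held_len[OF x, of y] div_le_mono[OF tot, of "input_size x"] net_ge_2[OF x] by simp
    then have "length (held x y) * input_size x \<le> (input_size x + 1) * input_size x"
      by (rule mult_le_mono1)
    moreover have "length (ms x y) \<le> length (held x y) * input_size x"
    proof (rule out_le)
      show "card {v. v < input_size x \<and> need x v a b} \<le> input_size x" for a b
        using card_mono[of "{..<input_size x}" "{v. v < input_size x \<and> need x v a b}"] by auto
    qed
    ultimately show "length (ms x y) \<le> input_size x * (input_size x + 1)"
      by (simp add: algebra_simps)
    assume v: "v < input_size x"
    have fin: "finite {(a, b). a < b \<and> {a, b} \<in> edges (fst x)}"
      by (rule finite_subset[of _ "{..<input_size x} \<times> {..<input_size x}"]) (use verts[OF x] in blast)+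
    have "(\<Sum>u<input_size x. count_class target (ms x u) v)
        \<le> card {(a, b). a < b \<and> {a, b} \<in> edges (fst x)}"
      unfolding into[OF x v] by (intro card_mono fin) auto
    also have "\<dots> \<le> card ({..<input_size x} \<times> {..<input_size x})"
      by (rule card_mono) (use verts[OF x] in blast)+
    finally show "(\<Sum>u<input_size x. count_class target (ms x u) v) \<le> input_size x * (input_size x + 1)"
      by simp
  qed
  have K: "(\<forall>y<input_size x. length (ms x y) \<le> input_size x * K x) \<and>
      (\<forall>v<input_size x. (\<Sum>u<input_size x. count_class target (ms x u) v) \<le> input_size x * K x)"
    if "x \<in> listing_inputs" for x
    unfolding K_def
  proof (rule LeastI[of _ "input_size x + 1"], intro conjI allI impI)
    show "length (ms x y) \<le> input_size x * (input_size x + 1)" for y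
      by (rule crude(1)[OF that])
    show "(\<Sum>u<input_size x. count_class target (ms x u) v) \<le> input_size x * (input_size x + 1)"
      if "v < input_size x" for v
      by (rule crude(2)[OF \<open>x \<in> listing_inputs\<close> that])
  qed
  have "knows (\<lambda>x v. (node_inputs x v, {(a, b). \<exists>u<input_size x. (a, b, v) \<in> set (ms x u)}))
      (\<lambda>x. (0 + 4) + 100 + 32 * K x)"
  proof (rule knows_routing[OF start, where d = 2])
    fix x assume x: "x \<in> listing_inputs"
    have n: "input_size x + 1 \<le> input_size x ^ 2"
      using net_ge_2[OF x] mult_le_mono1[OF net_ge_2[OF x], of "input_size x"]
      unfolding power2_eq_square by linarith
    show "K x \<le> input_size x ^ 2"
      using crude[OF x] by (intro order.trans[OF K_least n])
    show "packet_bounded (input_size x ^ 2) t \<and> target t < input_size x"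
      if u: "u < input_size x" and t: "t \<in> set (ms x u)" for u t
    proof -
      obtain a b v where abv: "t = (a, b, v)" by (rule prod_cases3)
      then have "v < input_size x" "a < input_size x" "b < input_size x"
        using received[OF x, of a b v] verts[OF x, of a b] u t by blast+
      with n show ?thesis by (simp add: packet_bounded_def abv)
    qed
    show "length (ms x u) \<le> input_size x * K x" if "u < input_size x" for u
      using K[OF x] that by simp
    show "(\<Sum>u<input_size x. count_class target (ms x u) v) \<le> input_size x * K x"
      if "v < input_size x" for v
      using K[OF x] that by simp
  qed
  then have "knows (\<lambda>x v. copies (fst (snd x)) (local_graph x v)) (\<lambda>x. (0 + 4) + 100 + 32 * K x)"
  proof (rule knows_determined)
    fix x y v
    assume x: "x \<in> listing_inputs" and y: "y \<in> listing_inputs"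
      and v: "v < input_size x" and n: "input_size y = input_size x"
      and eq: "(node_inputs x v, {(a, b). \<exists>u<input_size x. (a, b, v) \<in> set (ms x u)})
        = (node_inputs y v, {(a, b). \<exists>u<input_size y. (a, b, v) \<in> set (ms y u)})"
    have *: "local_graph z v = \<lparr>verts = {..<input_size z},
        edges = (\<lambda>(a, b). {a, b}) ` {(a, b). \<exists>u<input_size z. (a, b, v) \<in> set (ms z u)}\<rparr>"
      if "z \<in> listing_inputs" "v < input_size z" for z
    proof -
      have "edges (local_graph z v) = {{a, b} | a b. a < b \<and> {a, b} \<in> edges (fst z) \<and> need z v a b}"
        by (simp add: local_graph_def need_def input_size_def case_prod_unfold)
      also have "\<dots> = (\<lambda>(a, b). {a, b}) ` {(a, b). \<exists>u<input_size z. (a, b, v) \<in> set (ms z u)}"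
        unfolding received[OF that(1)] using that(2) by auto
      moreover have "verts (local_graph z v) = verts (fst z)"
        by (simp add: local_graph_def case_prod_unfold)
      ultimately show ?thesis
        unfolding VG[OF that(1)] by simp
    qed
    have "fst (snd x) = fst (snd y)"
      using eq by (cases x; cases y) (auto simp: node_inputs_def graph_input_def)
    then show "copies (fst (snd x)) (local_graph x v) = copies (fst (snd y)) (local_graph y v)"
      using *[OF x v] *[OF y] v n eq by simp
  qed
  then have 1: "knows (\<lambda>x v. copies (fst (snd x)) (local_graph x v)) (\<lambda>x. 104 + 32 * K x)"
    by simp
  have 2: "K (G, H, T) \<le> M"
    if x: "(G, H, T) \<in> listing_inputs"
      and s: "(card (edges G) div card (verts G) + 1) * (2 * card (edges H) *
        branching (card (verts G)) (card (verts H)) ^ (card (verts H) - 2)) \<le> card (verts G) * M"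
      and r: "\<And>v. card {(a, b). a < b \<and> {a, b} \<in> edges G \<and> needs (card (verts G)) H T v a b}
        \<le> card (verts G) * M" for G H T M
  proof (rule K_least)
    let ?D = "2 * card (edges H) * branching (card (verts G)) (card (verts H)) ^ (card (verts H) - 2)"
    fix y assume "y < input_size (G, H, T)"
    have "card {v. v < input_size (G, H, T) \<and> need (G, H, T) v a b} \<le> ?D" for a b
    proof -
      have T: "partition_tree (card (verts H)) (branching (card (verts G)) (card (verts H))) (verts G) T"
        and H: "simple_graph H"
        using x by (auto simp: listing_inputs_def)
      have "finite {v. needs (card (verts G)) H T v a b}"
        by (rule finite_subset[of _ "host (card (verts G)) (card (verts H)) T ` leaves (card (verts H)) T"])
          (auto simp: needs_def finite_leaves[OF T])
      then have "card {v. v < input_size (G, H, T) \<and> need (G, H, T) v a b}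
          \<le> card {v. needs (card (verts G)) H T v a b}"
        by (intro card_mono) (auto simp: need_def input_size_def)
      also have "\<dots> \<le> ?D"
        by (rule card_needs_le[OF T H refl])
      finally show ?thesis .
    qed
    then have "length (ms (G, H, T) y) \<le> length (held (G, H, T) y) * ?D"
      by (rule out_le)
    also have "length (held (G, H, T) y) \<le> card (edges G) div card (verts G) + 1"
      using held_len[OF x, of y] div_le_mono[OF total[OF x], of "card (verts G)"] by (simp add: input_size_def)
    finally show "length (ms (G, H, T) y) \<le> input_size (G, H, T) * M"
      using s by (simp add: input_size_def)
  next
    fix v assume "v < input_size (G, H, T)"
    then show "(\<Sum>u<input_size (G, H, T). count_class target (ms (G, H, T) u) v) \<le> input_size (G, H, T) * M"
      using into[OF x] r[of v] by (simp add: need_def input_size_def)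
  qed
  show ?thesis using that[OF 1 2] .
qed

text \<open>For r \<ge> 1 the floor of r exceeds r / 2, so rounding costs a factor of at most 4 in
  the square.\<close>

lemma branching_bounds:
  assumes "n \<ge> 1" "p \<ge> 1"
  shows "branching n p ^ p \<le> n" "branching n p \<ge> 1"
    "real n powr (2 / real p) \<le> 4 * (real (branching n p))\<^sup>2"
proof -
  define r where "r = real n powr (1 / real p)"
  have r1: "r \<ge> 1"
    using assms by (simp add: r_def ge_one_powr_ge_zero)
  have x: "real (branching n p) = of_int \<lfloor>r\<rfloor>"
    using r1 by (simp add: branching_def r_def)
  then have x_le: "real (branching n p) \<le> r" and x_gt: "r < real (branching n p) + 1"
    by linarith+
  have "real (branching n p ^ p) \<le> r ^ p"
    using x_le by (simp add: power_mono)
  also have "r ^ p = real n"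
    using assms by (simp add: r_def powr_power)
  finally show "branching n p ^ p \<le> n" by simp
  show one: "branching n p \<ge> 1"
    using x r1 by linarith
  have "real n powr (2 / real p) = r\<^sup>2"
    using assms by (simp add: r_def powr_power)
  also have "\<dots> \<le> (2 * real (branching n p))\<^sup>2"
    using x_gt one r1 by (intro power_mono) linarith+
  finally show "real n powr (2 / real p) \<le> 4 * (real (branching n p))\<^sup>2"
    by (simp add: power_mult_distrib)
qed

theorem theorem19:
  shows "\<exists>(A :: (node_input, ugraph set) cc_algorithm) (\<beta> :: real). \<forall>c1 c2 :: real. \<exists>C :: real.
    \<forall>(n :: nat) (m :: nat) (p :: nat) (k :: nat) (x :: nat) (G :: ugraph) (H :: ugraph) (T :: ptree).
      simple_graph G \<and> verts G = {..<n} \<and> card (edges G) = m \<and>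
      simple_graph H \<and> verts H = {..<p} \<and> card (edges H) = k \<and>
      1 \<le> p \<and> real p \<le> log 2 (real n) \<and> x = branching n p \<and>
      H_partition_tree c1 c2 p x H G T
      \<longrightarrow> respects_bandwidth A n (graph_input G H T) (\<beta> * log 2 (real n)) \<and>
          (\<exists>R :: nat.
             real R \<le> C * (real k * m_tilde n m x / real n powr (1 + 2 / real p) + real p) \<and>
             completes_within A n (graph_input G H T) R \<and>
             lists_instances A n H G T R)"
proof -
  obtain K where "clique_inputs.knows listing_inputs input_size node_inputs
       (\<lambda>x v. copies (fst (snd x)) (local_graph x v)) (\<lambda>x. 104 + 32 * K x)"
    and K: "\<And>G H T M. (G, H, T) \<in> listing_inputs \<Longrightarrow>
      (card (edges G) div card (verts G) + 1) * (2 * card (edges H) *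
        branching (card (verts G)) (card (verts H)) ^ (card (verts H) - 2)) \<le> card (verts G) * M \<Longrightarrow>
      (\<And>v. card {(a, b). a < b \<and> {a, b} \<in> edges G \<and> needs (card (verts G)) H T v a b}
        \<le> card (verts G) * M) \<Longrightarrow> K (G, H, T) \<le> M"
    using knows_listing by blast
  then obtain A :: "(node_input, ugraph set) cc_algorithm" and \<beta> :: real where
    A: "\<And>x. x \<in> listing_inputs \<Longrightarrow>
      respects_bandwidth A (input_size x) (node_inputs x) (\<beta> * log 2 (real (input_size x))) \<and>
      (\<exists>R\<le>104 + 32 * K x. halts_at A (input_size x) (node_inputs x) R
        (\<lambda>v. copies (fst (snd x)) (local_graph x v)))"
    unfolding clique_inputs.knows_def[OF clique_inputs_listing] by blast
  show ?thesis
  proof (rule exI[of _ A], rule exI[of _ \<beta>], intro allI)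
    fix c1 c2 :: real
    \<comment> \<open>The round count is at most 104 + 32 M with M \<le> (4 + |c2|) * 4 Q + 1 + p,
      where Q is the first term of the claimed bound. This gives 128 (4 + |c2|) Q, and 136 + 32 p
      \<le> 168 p as p \<ge> 1.\<close>
    let ?C = "168 + 128 * (4 + \<bar>c2\<bar>)"
    show "\<exists>C :: real. \<forall>n m p k x G H T.
      simple_graph G \<and> verts G = {..<n} \<and> card (edges G) = m \<and>
      simple_graph H \<and> verts H = {..<p} \<and> card (edges H) = k \<and>
      1 \<le> p \<and> real p \<le> log 2 (real n) \<and> x = branching n p \<and>
      H_partition_tree c1 c2 p x H G T
      \<longrightarrow> respects_bandwidth A n (graph_input G H T) (\<beta> * log 2 (real n)) \<and>
          (\<exists>R :: nat.
             real R \<le> C * (real k * m_tilde n m x / real n powr (1 + 2 / real p) + real p) \<and>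
             completes_within A n (graph_input G H T) R \<and>
             lists_instances A n H G T R)"
    proof (intro exI[of _ ?C] allI impI, elim conjE)
      fix n m p k x :: nat and G H :: ugraph and T :: ptree
      assume G: "simple_graph G" "verts G = {..<n}" "card (edges G) = m"
        and H: "simple_graph H" "verts H = {..<p}" "card (edges H) = k"
        and p: "1 \<le> p" "real p \<le> log 2 (real n)" and x: "x = branching n p"
        and T: "H_partition_tree c1 c2 p x H G T"
      \<comment> \<open>In HOL \<open>log 2 0 = 0\<close>, so p \<ge> 1 excludes n = 0 as well as n
        = 1.\<close>
      have n: "n \<ge> 2"
      proof (rule ccontr)
        assume "\<not> n \<ge> 2"
        then have "n = 0 \<or> n = 1" by linarith
        then have "log 2 (real n) = 0" by (auto simp: log_def)
        with p show False by simp
      qed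
      then have xp: "x ^ p \<le> n" and x1: "x \<ge> 1" and x4: "real n powr (2 / real p) \<le> 4 * (real x)\<^sup>2"
        using branching_bounds[of n p] p(1) by (auto simp: x)
      have cards: "card (verts G) = n" "card (verts H) = p"
        by (simp_all add: G H)
      have "partition_tree p x (verts G) T"
        using T by (simp add: H_partition_tree_def Let_def)
      then have inX: "(G, H, T) \<in> listing_inputs"
        using G(1,2) H(1,2) n xp unfolding listing_inputs_def x by blast
      define \<kappa> where "\<kappa> = real k * m_tilde n m x / (real n * (real x)\<^sup>2)"
      \<comment> \<open>The 4 is for sending, |c2| for receiving, and p for the summands
        \<open>+ n\<close> of the tree condition.\<close>
      define M where "M = nat \<lceil>(4 + \<bar>c2\<bar>) * \<kappa>\<rceil> + p"
      have mt: "real m \<le> m_tilde n m x" "real n \<le> m_tilde n m x"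
        using x1 mult_left_mono[of 1 "real x" "real n"] by (auto simp: m_tilde_def)
      have pos: "real n > 0" "real x > 0" using n x1 by auto
      have \<kappa>: "\<kappa> \<ge> 0" using mt pos by (simp add: \<kappa>_def)
      have M_ge: "(4 + \<bar>c2\<bar>) * \<kappa> + real p \<le> real M"
        unfolding M_def by linarith
      have M_le: "real M \<le> (4 + \<bar>c2\<bar>) * \<kappa> + 1 + real p"
      proof -
        have "(4 + \<bar>c2\<bar>) * \<kappa> \<ge> 0" using \<kappa> by simp
        then show ?thesis unfolding M_def by linarith
      qed
      have send: "(m div n + 1) * (2 * k * x ^ (p - 2)) \<le> n * M"
      \<comment> \<open>An edge of H forces p \<ge> 2, where the subtraction \<open>p - 2\<close> is
        not truncated and x^(p-2) \<le> n / x^2. Without edges nothing is sent.\<close>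
      proof (cases "k = 0")
        case False
        then obtain e where "e \<in> edges H" using H(3) by fastforce
        then have "e \<subseteq> {..<p}" "card e = 2"
          using H(1,2) by (auto simp: simple_graph_def)
        then have p2: "p \<ge> 2" using card_mono[of "{..<p}" e] by simp
        have "real (x ^ (p - 2)) * (real x)\<^sup>2 = real (x ^ p)"
          using p2 by (simp only: of_nat_power power_add[symmetric] le_add_diff_inverse2)
        also have "\<dots> \<le> real n" using xp by (simp only: of_nat_le_iff)
        finally have xx: "real (x ^ (p - 2)) \<le> real n / (real x)\<^sup>2"
          using pos by (simp add: pos_le_divide_eq)
        have "real ((m div n + 1) * (2 * k * x ^ (p - 2)))
            = (real (m div n) + 1) * (2 * real k * real (x ^ (p - 2)))"
          by (simp add: algebra_simps)
        also have "\<dots> \<le> (real m / real n + 1) * (2 * real k * (real n / (real x)\<^sup>2))"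
          using xx of_nat_div_le_of_nat[of m n] by (intro mult_mono add_mono) auto
        also have "\<dots> = 2 * real k * (real m + real n) / (real x)\<^sup>2"
          using pos by (simp add: field_simps)
        also have "\<dots> \<le> 2 * real k * (2 * m_tilde n m x) / (real x)\<^sup>2"
          using mt by (intro divide_right_mono mult_left_mono) auto
        also have "\<dots> = real n * (4 * \<kappa>)"
          using pos by (simp add: \<kappa>_def field_simps)
        also have "\<dots> \<le> real n * real M"
        proof (rule mult_left_mono)
          have "\<bar>c2\<bar> * \<kappa> \<ge> 0" using \<kappa> by simp
          then show "4 * \<kappa> \<le> real M" using M_ge by (simp add: distrib_right)
        qed simp
        finally show ?thesis by (simp only: of_nat_le_iff flip: of_nat_mult)
      qed simp
      have receive: "card {(a, b). a < b \<and> {a, b} \<in> edges G \<and> needs n H T v a b} \<le> n * M" for v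
      proof -
        have "real (card {(a, b). a < b \<and> {a, b} \<in> edges G \<and> needs n H T v a b})
            \<le> \<bar>c2\<bar> * real k * m_tilde n m x / (real x)\<^sup>2 + real p * real n"
          using card_needed_edges_le[OF T _ G(1) H(1)] xp cards G(3) H(3) by simp
        also have "\<dots> = real n * (\<bar>c2\<bar> * \<kappa> + real p)"
          using pos by (simp add: \<kappa>_def field_simps)
        also have "\<dots> \<le> real n * real M"
          using M_ge \<kappa> by (intro mult_left_mono) (auto simp: distrib_right)
        finally show ?thesis by (simp only: of_nat_le_iff flip: of_nat_mult)
      qed
      have "K (G, H, T) \<le> M"
        using K[OF inX, of M] send receive unfolding cards G(3) H(3) x[symmetric] by blast
      moreover have size: "input_size (G, H, T) = n" and inputs: "node_inputs (G, H, T) = graph_input G H T"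
        by (simp_all add: input_size_def node_inputs_def cards)
      ultimately obtain R where bw: "respects_bandwidth A n (graph_input G H T) (\<beta> * log 2 (real n))"
        and R: "R \<le> 104 + 32 * M"
        and halts: "halts_at A n (graph_input G H T) R (\<lambda>v. copies H (local_graph (G, H, T) v))"
        using A[OF inX] unfolding size inputs fst_conv snd_conv
        by (meson add_le_mono1 le_trans mult_le_mono2 nat_add_left_cancel_le)
      have "real R \<le> ?C * (real k * m_tilde n m x / real n powr (1 + 2 / real p) + real p)"
      proof -
        let ?Q = "real k * m_tilde n m x / real n powr (1 + 2 / real p)"
        have "real n powr (1 + 2 / real p) \<le> real n * (4 * (real x)\<^sup>2)"
          using x4 pos by (simp add: powr_add)
        then have "real k * m_tilde n m x / (real n * (4 * (real x)\<^sup>2)) \<le> ?Q"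
          using mt pos by (intro divide_left_mono mult_pos_pos) auto
        moreover have "\<kappa> = 4 * (real k * m_tilde n m x / (real n * (4 * (real x)\<^sup>2)))"
          using pos by (simp add: \<kappa>_def field_simps)
        ultimately have \<kappa>_le: "\<kappa> \<le> 4 * ?Q" by linarith
        have Q: "?Q \<ge> 0" using mt pos by simp
        have "real R \<le> 104 + 32 * real M"
          using R by linarith
        also have "\<dots> \<le> 104 + 32 * ((4 + \<bar>c2\<bar>) * (4 * ?Q) + 1 + real p)"
        proof -
          note M_le
          also have "(4 + \<bar>c2\<bar>) * \<kappa> + 1 + real p \<le> (4 + \<bar>c2\<bar>) * (4 * ?Q) + 1 + real p"
            using \<kappa>_le by (intro add_right_mono mult_left_mono) simp_all
          finally show ?thesis by (intro add_left_mono mult_left_mono) simp_all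
        qed
        also have "\<dots> = 128 * (4 + \<bar>c2\<bar>) * ?Q + (136 + 32 * real p)"
        proof -
          have "104 + 32 * (a * (4 * q) + 1 + r) = 128 * a * q + (136 + 32 * r)" for a q r :: real
            by (simp add: algebra_simps)
          then show ?thesis .
        qed
        also have "\<dots> \<le> ?C * ?Q + ?C * real p"
        proof (rule add_mono)
          show "128 * (4 + \<bar>c2\<bar>) * ?Q \<le> ?C * ?Q"
            using Q by (intro mult_right_mono) auto
          have "136 + 32 * real p \<le> 168 * real p" using p(1) by simp
          also have "\<dots> \<le> ?C * real p"
            by (intro mult_right_mono) auto
          finally show "136 + 32 * real p \<le> ?C * real p" .
        qed
        finally show ?thesis by (simp only: distrib_left)
      qed
      moreover have "completes_within A n (graph_input G H T) R"
        using halts by (simp add: completes_within_def halts_at_def)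
      moreover have "lists_instances A n H G T R"
      proof -
        have "(\<Union>v<n. the (node_output A n (graph_input G H T) R v))
            = (\<Union>v<n. copies H (local_graph (G, H, T) v))"
          using halts by (intro SUP_cong) (auto simp: halts_at_def)
        then show ?thesis
          using local_graph_copies[OF inX] by (simp add: lists_instances_def cards)
      qed
      ultimately show "respects_bandwidth A n (graph_input G H T) (\<beta> * log 2 (real n)) \<and>
          (\<exists>R :: nat.
             real R \<le> ?C * (real k * m_tilde n m x / real n powr (1 + 2 / real p) + real p) \<and>
             completes_within A n (graph_input G H T) R \<and>
             lists_instances A n H G T R)"
        using bw by blast
    qed
  qed
qed

end
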